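(* For every non-negative integer $n$, $$MO(10;11n+7)\equiv 0\pmod{11}.$$
   Context: For a positive integer $a$, the integers $MO(a;n)$ are the coefficients of the formal power series $$\sum_{n\geq0}MO(a;n)\,q^n:=\sum_{0< k_1<k_2<\cdots<k_a} \frac{q^{k_1+k_2+\cdots+k_a}}{(1-q^{k_1})^2(1-q^{k_2})^2\cdots(1-q^{k_a})^2}.$$ *)

theory Defs
  imports "HOL-Analysis.Analysis" "HOL-Number_Theory.Cong"
begin

definition increasing_tuples :: "nat \<Rightarrow> nat list set" where
  "increasing_tuples a = {ks. length ks = a \<and> sorted_wrt (<) ks \<and> (\<forall>k\<in>set ks. 0 < k)}"

definition MO_denom :: "nat list \<Rightarrow> int fps" where
  "MO_denom ks = (\<Prod>k\<leftarrow>ks. (1 - fps_X ^ k)\<^sup>2)"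

text \<open>
  Division of power series is not available over the integers, as it needs an inverse operation on
  the coefficients. But a series with constant term 1 is a unit, and \<open>fps_right_inverse f 1\<close> is its
  inverse; see \<open>MO_denom_inverse\<close>.
\<close>

definition MO_summand :: "nat list \<Rightarrow> int fps" where
  "MO_summand ks = fps_X ^ sum_list ks * fps_right_inverse (MO_denom ks) 1"

text \<open>
  The infinite sum is taken in the usual (\<open>X\<close>-adic) topology on formal power series, where it
  converges by \<open>MO_summable\<close>.
\<close>

definition MO_gf :: "nat \<Rightarrow> int fps" where
  "MO_gf a = (\<Sum>\<^sub>\<infinity>ks\<in>increasing_tuples a. MO_summand ks)"

definition MO :: "nat \<Rightarrow> nat \<Rightarrow> int" where
  "MO a n = fps_nth (MO_gf a) n"

lemma MO_denom_inverse:
  assumes "ks \<in> increasing_tuples a"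
  shows "MO_denom ks * fps_right_inverse (MO_denom ks) 1 = 1"
proof (rule fps_right_inverse)
  have "\<forall>k\<in>set ks. 0 < k \<Longrightarrow> fps_nth (MO_denom ks) 0 = 1"
    by (induction ks) (auto simp: MO_denom_def fps_nth_power_0 power2_eq_square zero_power)
  thus "fps_nth (MO_denom ks) 0 * 1 = 1"
    using assms by (simp add: increasing_tuples_def)
qed

lemma MO_summable: "MO_summand summable_on increasing_tuples a"
proof -
  have "finite {ks\<in>increasing_tuples a. fps_nth (MO_summand ks) n \<noteq> 0}" for n
  proof (rule finite_subset)
    show "{ks\<in>increasing_tuples a. fps_nth (MO_summand ks) n \<noteq> 0} \<subseteq>
            {ks. set ks \<subseteq> {..n} \<and> length ks = a}"
    proof safe
      fix ks k
      assume "ks \<in> increasing_tuples a" "fps_nth (MO_summand ks) n \<noteq> 0" "k \<in> set ks"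
      moreover from this have "sum_list ks \<le> n"
        by (auto simp: MO_summand_def fps_X_power_mult_nth split: if_splits)
      ultimately show "k \<le> n"
        using member_le_sum_list[of k ks] by simp
    qed (simp add: increasing_tuples_def)
  qed (simp add: finite_lists_length_eq)
  hence "(MO_summand has_sum Abs_fps (\<lambda>n. \<Sum>ks | ks \<in> increasing_tuples a \<and>
            fps_nth (MO_summand ks) n \<noteq> 0. fps_nth (MO_summand ks) n)) (increasing_tuples a)"
    by (intro has_sum_fpsI) simp_all
  thus ?thesis by (rule has_sum_imp_summable)
qed

end

theory Submission
  imports Defs "HOL-Computational_Algebra.Polynomial"
begin

text \<open>
  Write $(q)_\infty = \prod_{k\geq 1} (1 - q^k)$. With $x = 2 - z - z^{-1}$ one has
  $1 + x q^k / (1 - q^k)^2 = (1 - z q^k)(1 - z^{-1} q^k) / (1 - q^k)^2$, so by the Jacobi triple product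
  $(q)_\infty^3 \sum_a MO(a) x^a = \sum_{n\geq 0} (-1)^n q^{n(n+1)/2} (z^{-n} + \cdots + z^n)$.
  The coefficient of $x^{10}$ in $z^{-n} + \cdots + z^n$ is
  ${n+11 \choose 21} + {n+10 \choose 21}$, which is divisible by 11 unless $n \equiv 0, -1$ mod 11,
  in which case $11 \mid n(n+1)/2$. Hence $(q)_\infty^3 \sum_n MO(10; n) q^n$ is a series in
  $q^{11}$ modulo 11, and so is $(q)_\infty^{11}$; it remains to see that the coefficients of
  $(q)_\infty^8$ at exponents $\equiv 7$ mod 11 vanish modulo 11.

  For this, consider the sum of
  $(-1)^{n+m+k} (n+k-1)^2 (m+k-1) q^{T(n)+T(m)+T(k)}$ over all integers $n, m, k$, where
  $T(n) = n(n-1)/2$. The reflection $n \mapsto 1 - n$ kills all monomials of the weight that miss a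
  variable, leaving $2nmk$, i.e. $-2 (q)_\infty^9$ by Jacobi. On the other hand, with $i = n + k$ and
  $j = m + k$ fixed, the sum over $k$ is $\pm q^{*} (q)_\infty$ by the pentagonal number theorem if
  $i + j \equiv 0, 1$ mod 3, and 0 otherwise. Thus $-2 (q)_\infty^8$ is a sum of
  $\pm (i-1)^2 (j-1) q^{Q(i,j)}$ for a positive definite quadratic polynomial $Q$ whose
  discriminant makes $Q(i,j) \equiv 7$ mod 11 force $i \equiv 1$ mod 11.
\<close>

section \<open>A finite form of the Jacobi triple product\<close>

text \<open>
  The Gaussian binomial coefficient of $a + b$ over $a$; indexing it by $a$ and $b$ avoids truncated
  subtraction and makes it symmetric.
\<close>
fun qbinom :: "'a::comm_ring_1 \<Rightarrow> nat \<Rightarrow> nat \<Rightarrow> 'a" where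
  "qbinom q 0 b = 1"
| "qbinom q (Suc a) 0 = 1"
| "qbinom q (Suc a) (Suc b) = q ^ Suc a * qbinom q (Suc a) b + qbinom q a (Suc b)"

definition qpoch :: "'a::comm_ring_1 \<Rightarrow> nat \<Rightarrow> 'a" where
  "qpoch q n = (\<Prod>k=1..n. 1 - q ^ k)"

lemma qbinom_0_right [simp]: "qbinom q a 0 = 1"
  by (cases a) auto

text \<open>The mirrored Pascal rule. Expanding the left side by the recursion and then the
  induction hypothesis, and the right side by the recursion, leaves the same combination of
  \<open>qbinom q (Suc a) (b - 1)\<close>, \<open>qbinom q a b\<close> and
  \<open>qbinom q (a - 1) (Suc b)\<close>.\<close>

lemma qbinom_Suc_Suc':
  "qbinom q (Suc a) (Suc b) = qbinom q (Suc a) b + q ^ Suc b * qbinom q a (Suc b)"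
proof (induction "a + b" arbitrary: a b rule: less_induct)
  case less
  have A: "qbinom q a (Suc b) = qbinom q a b + q ^ Suc b * qbinom q (a - 1) (Suc b)" if "a > 0"
    using less[of "a - 1" b] that by (cases a) auto
  have B: "qbinom q (Suc a) b = qbinom q (Suc a) (b - 1) + q ^ b * qbinom q a b" if "b > 0"
    using less[of a "b - 1"] that by (cases b) auto
  have C: "qbinom q (Suc a) (Suc b) = q ^ Suc a * qbinom q (Suc a) b + qbinom q a (Suc b)"
    by simp
  have D: "qbinom q a (Suc b) = q ^ a * qbinom q a b + qbinom q (a - 1) (Suc b)" if "a > 0"
    using that by (cases a) auto
  have E: "qbinom q (Suc a) b = q ^ Suc a * qbinom q (Suc a) (b - 1) + qbinom q a b" if "b > 0"
    using that by (cases b) auto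
  consider "a > 0" "b > 0" | "a = 0" "b > 0" | "b = 0" "a > 0" | "a = 0" "b = 0" by auto
  thus ?case
  proof cases
    case 1
    have "q ^ Suc a * (qbinom q (Suc a) (b - 1) + q ^ b * qbinom q a b)
        + (qbinom q a b + q ^ Suc b * qbinom q (a - 1) (Suc b)) =
        q ^ Suc a * qbinom q (Suc a) (b - 1) + qbinom q a b +
        q ^ Suc b * (q ^ a * qbinom q a b + qbinom q (a - 1) (Suc b))"
      by (simp add: algebra_simps del: qbinom.simps)
    thus ?thesis using A B C D E 1 by metis
  next
    case 2
    have "q * (qbinom q 1 (b - 1) + q ^ b) + 1 = q * qbinom q 1 (b - 1) + 1 + q ^ Suc b"
      by (simp add: algebra_simps del: qbinom.simps)
    thus ?thesis using B C E 2 by simp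
  next
    case 3
    have "q ^ Suc a * qbinom q (Suc a) b + qbinom q a (Suc b) =
            q ^ Suc a + (1 + q * qbinom q (a - 1) 1)"
      using A 3 by simp
    also have "\<dots> = 1 + q * qbinom q a 1"
      using D 3 by (simp add: algebra_simps)
    finally show ?thesis unfolding C using 3 by simp
  qed simp
qed

lemma qbinom_sym: "qbinom q a b = qbinom q b a"
proof (induction q a b rule: qbinom.induct)
  case (3 q a b)
  thus ?case by (simp only: qbinom.simps(3)[of q a b] qbinom_Suc_Suc'[of q b a]) (simp add: ac_simps)
qed auto

text \<open>The quotient formula for Gaussian binomials in division-free form. The Pascal step rests
  on q^(a+1) (1 - q^(b+1)) + (1 - q^(a+1)) = 1 - q^(a+b+2).\<close>

lemma qbinom_mult_qpoch: "qbinom q a b * qpoch q a * qpoch q b = qpoch q (a + b)"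
proof (induction q a b rule: qbinom.induct)
  case (3 q a b)
  have S: "qpoch q (Suc n) = qpoch q n * (1 - q ^ Suc n)" for n
    by (simp add: qpoch_def del: power_Suc)
  have "qbinom q (Suc a) (Suc b) * qpoch q (Suc a) * qpoch q (Suc b) =
        q ^ Suc a * (1 - q ^ Suc b) * (qbinom q (Suc a) b * qpoch q (Suc a) * qpoch q b) +
        (1 - q ^ Suc a) * (qbinom q a (Suc b) * qpoch q a * qpoch q (Suc b))"
    by (simp add: S[of a] S[of b] algebra_simps)
  also have "\<dots> = (q ^ Suc a * (1 - q ^ Suc b) + (1 - q ^ Suc a)) * qpoch q (Suc (a + b))"
    unfolding 3 by (simp add: algebra_simps)
  also have "\<dots> = qpoch q (Suc a + Suc b)"
    using S[of "Suc (a + b)"] by (simp add: algebra_simps power_add)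
  finally show ?case .
qed (auto simp: qpoch_def)

text \<open>Two Pascal steps, using both forms of the rule. This is the recursion of
  \<open>jtp_coeff\<close> once signs and triangular powers of q are stripped.\<close>

lemma qbinom_Suc_Suc_Suc_Suc:
  "qbinom q (Suc (Suc a)) (Suc (Suc b)) =
     (1 + q ^ (a + b + 3)) * qbinom q (Suc a) (Suc b) +
     q ^ (a + 2) * qbinom q (Suc (Suc a)) b + q ^ (b + 2) * qbinom q a (Suc (Suc b))"
  unfolding qbinom.simps(3)[of q "Suc a" "Suc b"] qbinom_Suc_Suc'[of q "Suc a" b]
    qbinom_Suc_Suc'[of q a "Suc b"]
  by (simp add: algebra_simps power_add eval_nat_numeral)

text \<open>
  $z^{-n} + z^{-n+1} + \cdots + z^n$ as a polynomial in $x = 2 - z - z^{-1}$.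
\<close>
fun Wpoly :: "'a::comm_ring_1 \<Rightarrow> nat \<Rightarrow> 'a" where
  "Wpoly x 0 = 1"
| "Wpoly x (Suc 0) = 3 - x"
| "Wpoly x (Suc (Suc n)) = (2 - x) * Wpoly x (Suc n) - Wpoly x n"

text \<open>
  The recursion comes from multiplying by $1 + q^{2N+2} - q^{N+1} (2 - x)$ and using
  $(2 - x) W_n = W_{n+1} + W_{n-1}$ with $W_{-1} = -W_0$.
\<close>
fun jtp_coeff :: "'a::comm_ring_1 \<Rightarrow> nat \<Rightarrow> nat \<Rightarrow> 'a" where
  "jtp_coeff q 0 n = (if n = 0 then 1 else 0)"
| "jtp_coeff q (Suc N) 0 =
     (1 + q ^ (2 * N + 2)) * jtp_coeff q N 0 - q ^ Suc N * (jtp_coeff q N 1 - jtp_coeff q N 0)"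
| "jtp_coeff q (Suc N) (Suc n) =
     (1 + q ^ (2 * N + 2)) * jtp_coeff q N (Suc n)
       - q ^ Suc N * (jtp_coeff q N n + jtp_coeff q N (Suc (Suc n)))"

lemmas [simp del] = jtp_coeff.simps

text \<open>The Gaussian binomial is the one of 2N+1 over N-n, and
  \<open>qbinom_Suc_Suc_Suc_Suc\<close> is the induction step. The cases n = 0 and n >= N stand
  apart because a neighbouring index leaves the range there.\<close>

lemma jtp_coeff_eq:
  "jtp_coeff q N n =
     (if n \<le> N then (-1) ^ n * q ^ (Suc n choose 2) * qbinom q (N - n) (N + n + 1) else 0)"
proof (induction N arbitrary: n)
  case 0
  show ?case by (auto simp: numeral_2_eq_2 jtp_coeff.simps)
next
  case (Suc N n)
  note IH = Suc.IH
  have tri: "Suc (Suc m) choose 2 = Suc m + (Suc m choose 2)" for m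
    by (simp add: numeral_2_eq_2)
  have tri0: "Suc 0 choose 2 = 0" "Suc (Suc 0) choose 2 = 1"
    by (simp_all add: numeral_2_eq_2)
  show ?case
  proof (cases n)
    case 0
    show ?thesis
    proof (cases N)
      case N: 0
      thus ?thesis using 0
        by (simp add: jtp_coeff.simps algebra_simps eval_nat_numeral)
    next
      case (Suc M)
      define B0 B1 B2 B3 where "B0 = qbinom q (M + 2) (M + 3)" "B1 = qbinom q (M + 1) (M + 2)"
        "B2 = qbinom q (M + 2) (M + 1)" "B3 = qbinom q M (M + 3)"
      have *: "B0 = (1 + q ^ (2 * M + 4)) * B1 + q ^ (M + 2) * B2 + q ^ (M + 3) * B3"
        using qbinom_Suc_Suc_Suc_Suc[of q M "Suc M"]
        by (simp add: B0_B1_B2_B3_def mult_2 eval_nat_numeral del: qbinom.simps power_Suc)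
      \<comment> \<open>In the three-term recursion the coefficient at index -1 would be minus the
        one at index 0; for Gaussian binomials this is their symmetry.\<close>
      have sym: "B2 = B1" unfolding B0_B1_B2_B3_def by (rule qbinom_sym)
      have 1: "jtp_coeff q N 0 = B1"
        unfolding IH[of 0] using Suc by (simp add: tri0 B0_B1_B2_B3_def)
      have 2: "jtp_coeff q N 1 = -q * B3"
        unfolding IH[of 1] using Suc by (simp add: tri0 B0_B1_B2_B3_def eval_nat_numeral del: qbinom.simps)
      have 3: "qbinom q (Suc N - n) (Suc N + n + 1) = B0"
        using Suc 0 by (simp add: B0_B1_B2_B3_def eval_nat_numeral)
      show ?thesis unfolding 3 unfolding 0 jtp_coeff.simps 1 2 * sym
        by (simp add: Suc tri0 algebra_simps power_add mult_2 eval_nat_numeral del: qbinom.simps)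
    qed
  next
    case n: (Suc m)
    consider "n < N" | "n = N" | "n = Suc N" | "n > Suc N" by linarith
    thus ?thesis
    proof cases
      case 1
      then obtain d where "N = Suc (n + d)"
        using less_imp_Suc_add by blast
      hence d: "N = m + d + 2" using n by simp
      define B0 B1 B2 B3 where "B0 = qbinom q (d + 2) (2 * m + d + 5)"
        "B1 = qbinom q (d + 1) (2 * m + d + 4)"
        "B2 = qbinom q (d + 2) (2 * m + d + 3)" "B3 = qbinom q d (2 * m + d + 5)"
      have *: "B0 = (1 + q ^ (2 * m + 2 * d + 6)) * B1 + q ^ (d + 2) * B2 + q ^ (2 * m + d + 5) * B3"
        using qbinom_Suc_Suc_Suc_Suc[of q d "2 * m + d + 3"]
        by (simp add: B0_B1_B2_B3_def mult_2 eval_nat_numeral add_ac del: qbinom.simps power_Suc)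
      define t where "t = Suc m choose 2"
      have 1: "jtp_coeff q N (Suc m) = - ((-1) ^ m * q ^ (Suc m + t) * B1)"
        unfolding IH[of "Suc m"] tri t_def[symmetric] using d
        by (simp add: B0_B1_B2_B3_def eval_nat_numeral add_ac del: qbinom.simps)
      have 2: "jtp_coeff q N m = ((-1) ^ m * q ^ t * B2)"
        unfolding IH[of m] tri t_def[symmetric] using d
        by (simp add: B0_B1_B2_B3_def eval_nat_numeral add_ac del: qbinom.simps)
      have 3: "jtp_coeff q N (Suc (Suc m)) = ((-1) ^ m * q ^ (2 * m + 3 + t) * B3)"
        unfolding IH[of "Suc (Suc m)"] tri t_def[symmetric] using d
        by (simp add: B0_B1_B2_B3_def eval_nat_numeral add_ac del: qbinom.simps)
      have 4: "(if n \<le> Suc N then (- 1) ^ n * q ^ (Suc n choose 2) *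
                  qbinom q (Suc N - n) (Suc N + n + 1) else 0) = - ((-1) ^ m * q ^ (Suc m + t) * B0)"
        unfolding n tri t_def[symmetric] using d
        by (simp add: B0_B1_B2_B3_def eval_nat_numeral add_ac del: qbinom.simps)
      show ?thesis unfolding 4 *
        unfolding n jtp_coeff.simps 1 2 3
        by (simp add: d algebra_simps power_add mult_2 eval_nat_numeral del: qbinom.simps)
    next
      case 2
      define B2 where "B2 = qbinom q 1 (2 * m + 2)"
      \<comment> \<open>The four-term identity with first index a = -1, where the last term drops
        out.\<close>
      have *: "qbinom q 1 (2 * m + 4) = (1 + q ^ (2 * m + 4)) + q * B2"
        using qbinom_Suc_Suc'[of q 0 "2 * m + 3"] qbinom.simps(3)[of q 0 "2 * m + 2"]
        by (simp add: B2_def algebra_simps eval_nat_numeral)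
      define t where "t = Suc m choose 2"
      have 1: "jtp_coeff q N (Suc m) = - ((-1) ^ m * q ^ (Suc m + t))"
        unfolding IH[of "Suc m"] tri t_def[symmetric] using 2 n by auto
      have N: "N - m = Suc 0" "N + m + 1 = 2 * m + 2" using 2 n by auto
      have 2: "jtp_coeff q N m = ((-1) ^ m * q ^ t * B2)"
        unfolding IH[of m] tri t_def[symmetric] N B2_def using 2 n by simp
      have 3: "jtp_coeff q N (Suc (Suc m)) = 0"
        unfolding IH[of "Suc (Suc m)"] using \<open>n = N\<close> n by simp
      have 4: "(if n \<le> Suc N then (- 1) ^ n * q ^ (Suc n choose 2) *
                  qbinom q (Suc N - n) (Suc N + n + 1) else 0) =
              - ((-1) ^ m * q ^ (Suc m + t) * qbinom q 1 (2 * m + 4))"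
        unfolding n tri t_def[symmetric] using \<open>n = N\<close> n
        by (auto simp add: eval_nat_numeral Suc_diff_le simp del: qbinom.simps)
      have N': "N = m + 1" using \<open>n = N\<close> n by simp
      have p: "q ^ (2 * N + 2) = q ^ (2 * m + 4)" "q ^ Suc N = q ^ (Suc m) * q"
        by (simp_all add: N' eval_nat_numeral)
      show ?thesis unfolding 4 *
        unfolding n jtp_coeff.simps 1 2 3 p
        by (simp add: algebra_simps power_add del: qbinom.simps)
    next
      case 3
      thus ?thesis using n
        by (simp add: jtp_coeff.simps IH tri power_add)
    next
      case 4
      thus ?thesis using n
        by (simp add: jtp_coeff.simps IH)
    qed
  qed
qed

text \<open>A finite Jacobi triple product in x instead of z, over any commutative ring, so that x
  may later be a constant or an indeterminate. The new factor is 1 + q^(2N+2) - q^(N+1) (2 - x), and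
  multiplication by 2 - x moves the index of \<open>Wpoly\<close> up and down by one.\<close>

lemma prod_eq_sum_Wpoly:
  "(\<Prod>k=1..N. (1 - q ^ k)\<^sup>2 + x * q ^ k) = (\<Sum>n\<le>N. jtp_coeff q N n * Wpoly x n)"
proof (induction N)
  case 0
  show ?case by (simp add: jtp_coeff.simps)
next
  case (Suc N)
  let ?c = "jtp_coeff q N"
  define S where "S = (\<Sum>n\<le>N. ?c n * Wpoly x n)"
  define S0 where "S0 = (\<Sum>n\<le>N. ?c (Suc n) * Wpoly x (Suc n))"
  define S1 where "S1 = (\<Sum>n\<le>N. ?c n * Wpoly x (Suc n))"
  define S2 where "S2 = (\<Sum>n\<le>N. ?c (Suc (Suc n)) * Wpoly x (Suc n))"
  \<comment> \<open>Because of these zeros all index-shifted sums can keep the range n \<le>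
    N.\<close>
  have 0: "?c (Suc N) = 0" "?c (Suc (Suc N)) = 0" by (auto simp: jtp_coeff_eq)
  have S: "S = ?c 0 + S0"
    using sum.atMost_Suc_shift[of "\<lambda>n. ?c n * Wpoly x n" N] 0 by (simp add: S_def S0_def)
  have "S1 = ?c 0 * (3 - x) + (\<Sum>n\<le>N. ?c (Suc n) * Wpoly x (Suc (Suc n)))"
    using sum.atMost_Suc_shift[of "\<lambda>n. ?c n * Wpoly x (Suc n)" N] 0
    by (simp add: S1_def del: Wpoly.simps(3))
  moreover have "S2 + ?c 1 = (\<Sum>n\<le>N. ?c (Suc n) * Wpoly x n)"
    using sum.atMost_Suc_shift[of "\<lambda>n. ?c (Suc n) * Wpoly x n" N] 0
    by (simp add: S2_def del: Wpoly.simps(3))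
  hence "S2 = (\<Sum>n\<le>N. ?c (Suc n) * Wpoly x n) - ?c 1"
    by (simp only: eq_diff_eq)
  moreover have "(\<Sum>n\<le>N. ?c (Suc n) * Wpoly x (Suc (Suc n))) + (\<Sum>n\<le>N. ?c (Suc n) * Wpoly x n)
                  = (2 - x) * S0"
    unfolding S0_def sum_distrib_left sum.distrib[symmetric]
    by (intro sum.cong refl) (simp add: algebra_simps)
  ultimately have S12: "S1 + S2 = ?c 0 * (3 - x) + (2 - x) * S0 - ?c 1"
    by (simp only: add_diff_eq add.assoc)
  have "(\<Sum>n\<le>Suc N. jtp_coeff q (Suc N) n * Wpoly x n) = jtp_coeff q (Suc N) 0 +
          (\<Sum>n\<le>N. jtp_coeff q (Suc N) (Suc n) * Wpoly x (Suc n))"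
    by (simp only: sum.atMost_Suc_shift Wpoly.simps mult_1_right)
  also have "(\<Sum>n\<le>N. jtp_coeff q (Suc N) (Suc n) * Wpoly x (Suc n)) =
      (1 + q ^ (2 * N + 2)) * S0 - q ^ Suc N * (S1 + S2)"
    unfolding jtp_coeff.simps S0_def S1_def S2_def sum.distrib[symmetric] sum_distrib_left
      sum_subtractf[symmetric]
    by (intro sum.cong refl) (simp add: algebra_simps del: Wpoly.simps)
  also have "jtp_coeff q (Suc N) 0 + \<dots> = (1 + q ^ (2 * N + 2)) * (?c 0 + S0)
        - q ^ Suc N * ((?c 1 - ?c 0) + (S1 + S2))"
    by (simp add: jtp_coeff.simps algebra_simps)
  also have "(?c 1 - ?c 0) + (S1 + S2) = (2 - x) * S"
    unfolding S12 S by (simp add: algebra_simps)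
  also have "(1 + q ^ (2 * N + 2)) * (?c 0 + S0) - q ^ Suc N * ((2 - x) * S) =
      S * ((1 - q ^ Suc N)\<^sup>2 + x * q ^ Suc N)"
  proof -
    have "q ^ (2 * N + 2) = (q ^ Suc N) * (q ^ Suc N)"
      unfolding power_add[symmetric] by (rule arg_cong[of _ _ "power q"]) simp
    thus ?thesis unfolding S[symmetric]
      by (simp add: algebra_simps power2_eq_square del: power_Suc)
  qed
  finally show ?case
    using Suc by (simp add: S_def)
qed

section \<open>Passage to the limit\<close>

text \<open>Congruence modulo X^(M+1). Limits of the finite identities are taken by proving it for
  every M.\<close>

definition agree :: "nat \<Rightarrow> 'a::zero fps \<Rightarrow> 'a fps \<Rightarrow> bool" where
  "agree M f g \<longleftrightarrow> (\<forall>n\<le>M. fps_nth f n = fps_nth g n)"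

lemma agree_refl [simp]: "agree M f f"
  by (simp add: agree_def)

lemma agree_sym: "agree M f g \<Longrightarrow> agree M g f"
  by (simp add: agree_def)

lemma agree_trans [trans]: "agree M f g \<Longrightarrow> agree M g h \<Longrightarrow> agree M f h"
  by (simp add: agree_def)

lemma agree_mult:
  fixes f g f' g' :: "'a::comm_ring_1 fps"
  shows "agree M f f' \<Longrightarrow> agree M g g' \<Longrightarrow> agree M (f * g) (f' * g')"
  unfolding agree_def by (auto simp: fps_mult_nth intro!: sum.cong)

lemma agree_power:
  fixes f g :: "'a::comm_ring_1 fps"
  shows "agree M f g \<Longrightarrow> agree M (f ^ n) (g ^ n)"
  by (induction n) (auto intro: agree_mult)

lemma agree_sum:
  "(\<And>x. x \<in> A \<Longrightarrow> agree M (f x) (g x)) \<Longrightarrow> agree M (\<Sum>x\<in>A. f x) (\<Sum>x\<in>A. g x)"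
  unfolding agree_def by (auto simp: fps_sum_nth)

lemma fps_eqI_agree: "(\<And>M. agree M f g) \<Longrightarrow> f = g"
  unfolding agree_def by (auto simp: fps_eq_iff)

lemma agree_mult_cancel:
  fixes f g h :: "'a::comm_ring_1 fps"
  assumes "agree M (h * f) (h * g)" "fps_nth h 0 = 1"
  shows   "agree M f g"
proof -
  define i where "i = fps_right_inverse h 1"
  have i: "i * h = 1"
    using fps_right_inverse[of h 1] assms(2) by (simp add: i_def mult.commute)
  have "agree M (i * (h * f)) (i * (h * g))"
    by (intro agree_mult assms) auto
  thus ?thesis
    unfolding mult.assoc[symmetric] i by simp
qed

section \<open>Euler's product and series over triangular exponents\<close>

text \<open>The infinite product of all 1 - X^k. Its n-th coefficient is read off the n-th partial
  product, since later factors no longer change it.\<close>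

definition euler :: "int fps" where
  "euler = Abs_fps (\<lambda>n. fps_nth (qpoch fps_X n) n)"

lemma qpoch_Suc: "qpoch q (Suc n) = qpoch q n * (1 - q ^ Suc n)"
  by (simp add: qpoch_def del: power_Suc)

lemma agree_qpoch_euler:
  assumes "N \<ge> M"
  shows   "agree M (qpoch fps_X N) euler"
proof -
  have "fps_nth (qpoch fps_X N) n = fps_nth (qpoch fps_X n :: int fps) n" if "n \<le> N" for n N
    using that
  proof (induction N rule: dec_induct)
    case (step k)
    thus ?case
      unfolding qpoch_Suc right_diff_distrib fps_sub_nth fps_X_power_mult_right_nth by simp
  qed auto
  from this[of _ N] show ?thesis
    using assms unfolding agree_def euler_def fps_nth_Abs_fps by (meson order_trans)
qed

lemma euler_nth_0 [simp]: "fps_nth euler 0 = 1"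
  by (simp add: euler_def qpoch_def)

text \<open>The series with terms c(n) X^(n(n+1)/2). The bound n \<le> m loses nothing because n
  \<le> n(n+1)/2.\<close>

definition triseries :: "(nat \<Rightarrow> int) \<Rightarrow> int fps" where
  "triseries c = Abs_fps (\<lambda>m. \<Sum>n\<le>m. if Suc n choose 2 = m then c n else 0)"

lemma le_Suc_choose_two: "n \<le> Suc n choose 2"
  by (simp add: numeral_2_eq_2)

lemma triseries_eq_sum:
  assumes "N \<ge> M"
  shows   "agree M (\<Sum>n\<le>N. fps_const (c n) * fps_X ^ (Suc n choose 2)) (triseries c)"
  unfolding agree_def
proof safe
  fix m assume "m \<le> M"
  have "fps_nth (\<Sum>n\<le>N. fps_const (c n) * fps_X ^ (Suc n choose 2)) m =
        (\<Sum>n\<le>N. if Suc n choose 2 = m then c n else 0)"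
    by (auto simp: fps_sum_nth intro!: sum.cong)
  also have "\<dots> = (\<Sum>n\<le>m. if Suc n choose 2 = m then c n else 0)"
    by (rule sum.mono_neutral_right)
       (use \<open>m \<le> M\<close> assms le_Suc_choose_two in \<open>auto split: if_splits simp: not_le simp del: binomial_Suc_Suc\<close>)
  finally show "fps_nth (\<Sum>n\<le>N. fps_const (c n) * fps_X ^ (Suc n choose 2)) m =
      fps_nth (triseries c) m"
    by (simp add: triseries_def)
qed

text \<open>For n \<le> M the Gaussian binomial is a quotient of partial products with at least M
  factors each, hence congruent to 1 / \<open>euler\<close>; N \<ge> 2M guarantees N - n \<ge> M.
  For n > M both sides vanish modulo X^(M+1).\<close>

lemma agree_euler_mult_jtp_coeff:
  assumes "N \<ge> 2 * M" "n \<le> N"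
  shows   "agree M (euler * jtp_coeff fps_X N n) ((-1) ^ n * fps_X ^ (Suc n choose 2))"
proof (cases "n > M")
  case True
  hence "(Suc n choose 2) > M"
    using le_Suc_choose_two[of n] by linarith
  have *: "euler * jtp_coeff fps_X N n =
      fps_X ^ (Suc n choose 2) * (euler * (-1) ^ n * qbinom fps_X (N - n) (N + n + 1))"
    using assms(2) by (simp only: jtp_coeff_eq if_True mult_ac)
  show ?thesis
    unfolding agree_def * mult.commute[of "(-1) ^ n" "fps_X ^ (Suc n choose 2)"]
      fps_X_power_mult_nth using \<open>(Suc n choose 2) > M\<close> by simp
next
  case False
  define B where "B = (qbinom fps_X (N - n) (N + n + 1) :: int fps)"
  have "agree M (euler * (euler * B)) (B * qpoch fps_X (N - n) * qpoch fps_X (N + n + 1))"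
  proof -
    have "agree M (B * euler * euler) (B * qpoch fps_X (N - n) * qpoch fps_X (N + n + 1))"
      using False assms by (intro agree_mult agree_refl agree_sym[OF agree_qpoch_euler]) auto
    thus ?thesis by (simp only: mult_ac)
  qed
  also have "B * qpoch fps_X (N - n) * qpoch fps_X (N + n + 1) = qpoch fps_X (N - n + (N + n + 1))"
    unfolding B_def by (rule qbinom_mult_qpoch)
  also have "agree M \<dots> (euler * 1)"
    using False assms by (simp add: agree_qpoch_euler)
  finally have "agree M (euler * B) 1"
    by (rule agree_mult_cancel) simp
  hence "agree M ((-1) ^ n * fps_X ^ (Suc n choose 2) * (euler * B))
                 ((-1) ^ n * fps_X ^ (Suc n choose 2) * 1)"
    by (intro agree_mult agree_refl)
  thus ?thesis using assms(2)
    by (simp add: jtp_coeff_eq B_def mult_ac)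
qed

lemma agree_triseries:
  assumes "N \<ge> 2 * M"
  shows   "agree M (euler * (\<Sum>n\<le>N. jtp_coeff fps_X N n * fps_const (c n)))
                 (triseries (\<lambda>n. (-1) ^ n * c n))"
proof -
  have "euler * (\<Sum>n\<le>N. jtp_coeff fps_X N n * fps_const (c n)) =
        (\<Sum>n\<le>N. (euler * jtp_coeff fps_X N n) * fps_const (c n))"
    by (simp add: sum_distrib_left mult.assoc)
  also have "agree M \<dots> (\<Sum>n\<le>N. ((-1) ^ n * fps_X ^ (Suc n choose 2)) * fps_const (c n))"
    using assms by (intro agree_sum agree_mult agree_euler_mult_jtp_coeff) auto
  also have "\<dots> = (\<Sum>n\<le>N. fps_const ((-1) ^ n * c n) * fps_X ^ (Suc n choose 2))"
  proof (intro sum.cong refl)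
    fix n
    have "fps_const ((-1) ^ n * c n) = (-1) ^ n * fps_const (c n)"
      by (cases "even n") simp_all
    thus "(-1) ^ n * fps_X ^ (Suc n choose 2) * fps_const (c n) =
        fps_const ((-1) ^ n * c n) * fps_X ^ (Suc n choose 2)"
      by (simp only: mult_ac)
  qed
  also have "agree M \<dots> (triseries (\<lambda>n. (-1) ^ n * c n))"
    using assms by (intro triseries_eq_sum) auto
  finally show ?thesis .
qed

lemma Wpoly_fps_const: "Wpoly (fps_const x) n = fps_const (Wpoly x n)"
proof (induction x n rule: Wpoly.induct)
  case (3 x n)
  show ?case
    unfolding Wpoly.simps 3 fps_numeral_fps_const by simp
next
  case (2 x)
  show ?case
    unfolding Wpoly.simps fps_numeral_fps_const by simp
qed auto

text \<open>Jacobi's identity: the case x = 0, that is z = 1, where W_n = 2n + 1.\<close>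

lemma euler_cube: "euler ^ 3 = triseries (\<lambda>n. (-1) ^ n * (2 * int n + 1))"
proof (rule fps_eqI_agree)
  fix M :: nat
  have W: "Wpoly 0 n = 2 * int n + 1" for n
    by (induction "0 :: int" n rule: Wpoly.induct) auto
  have "agree M (euler ^ 3) (euler * qpoch fps_X (2 * M) ^ 2)"
    unfolding power3_eq_cube power2_eq_square mult.assoc
    by (intro agree_mult agree_refl agree_sym[OF agree_qpoch_euler]) auto
  also have "qpoch fps_X (2 * M) ^ 2 =
      (\<Prod>k=1..2*M. (1 - fps_X ^ k)\<^sup>2 + fps_const 0 * fps_X ^ k :: int fps)"
    by (simp add: qpoch_def prod_power_distrib)
  also have "\<dots> = (\<Sum>n\<le>2*M. jtp_coeff fps_X (2*M) n * Wpoly (fps_const 0) n)"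
    by (rule prod_eq_sum_Wpoly)
  also have "agree M (euler * (\<Sum>n\<le>2*M. jtp_coeff fps_X (2*M) n * Wpoly (fps_const 0) n))
               (triseries (\<lambda>n. (-1) ^ n * (2 * int n + 1)))"
    unfolding Wpoly_fps_const W by (rule agree_triseries) auto
  finally show "agree M (euler ^ 3) (triseries (\<lambda>n. (-1) ^ n * (2 * int n + 1)))" .
qed

section \<open>Euler's product in \<open>X^3\<close>\<close>

lemma agree_compose: "agree M f g \<Longrightarrow> agree M (f oo h) (g oo h)"
  by (auto simp: agree_def fps_compose_nth intro!: sum.cong)

lemma qpoch_compose:
  fixes h :: "'a::idom fps"
  assumes "fps_nth h 0 = 0"
  shows   "qpoch fps_X N oo h = qpoch h N"
proof (induction N)
  case 0
  show ?case by (simp add: qpoch_def)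
next
  case (Suc N)
  have "(1 - fps_X ^ Suc N) oo h = 1 - h ^ Suc N"
    unfolding fps_compose_sub_distrib fps_compose_power[OF assms, symmetric]
      fps_X_fps_compose_startby0[OF assms] by (simp only: fps_compose_1)
  thus ?case
    by (simp only: qpoch_Suc fps_compose_mult_distrib[OF assms] Suc)
qed

definition euler3 :: "int fps" where
  "euler3 = euler oo fps_X ^ 3"

lemma euler3_nth: "fps_nth euler3 n = (if 3 dvd n then fps_nth euler (n div 3) else 0)"
proof -
  have "fps_nth euler3 n = (\<Sum>i=0..n. if i = n div 3 then (if 3 dvd n then fps_nth euler i else 0) else 0)"
    unfolding euler3_def fps_compose_nth
  proof (intro sum.cong refl)
    fix i
    have "fps_nth ((fps_X ^ 3) ^ i :: int fps) n = (if n = 3 * i then 1 else 0)"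
      unfolding power_mult[symmetric] fps_X_power_nth ..
    thus "fps_nth euler i * fps_nth ((fps_X ^ 3) ^ i) n =
         (if i = n div 3 then (if 3 dvd n then fps_nth euler i else 0) else 0)"
      by auto
  qed
  also have "\<dots> = (if 3 dvd n then fps_nth euler (n div 3) else 0)"
    by (subst sum.delta) auto
  finally show ?thesis .
qed

lemma agree_qpoch_euler3:
  assumes "N \<ge> M"
  shows   "agree M (qpoch (fps_X ^ 3) N) euler3"
  using agree_compose[OF agree_qpoch_euler[OF assms], of "fps_X ^ 3"]
  by (simp add: euler3_def qpoch_compose)

text \<open>
  At $x = 3$, that is, $z$ a primitive cube root of unity, the factor is
  $1 + q^k + q^{2k} = (1 - q^{3k}) / (1 - q^k)$.
\<close>
lemma euler3_eq: "euler3 = triseries (\<lambda>n. (-1) ^ n * Wpoly 3 n)"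
proof (rule fps_eqI_agree)
  fix M :: nat
  have "agree M euler3 (qpoch (fps_X ^ 3) (2 * M))"
    by (intro agree_sym[OF agree_qpoch_euler3]) auto
  also have "qpoch (fps_X ^ 3) (2 * M) = qpoch fps_X (2 * M) *
      (\<Prod>k=1..2*M. (1 - fps_X ^ k)\<^sup>2 + fps_const 3 * fps_X ^ k :: int fps)"
    unfolding qpoch_def prod.distrib[symmetric]
  proof (rule prod.cong)
    fix k
    have *: "1 - y ^ 3 = (1 - y) * ((1 - y)\<^sup>2 + fps_const 3 * y)" for y :: "int fps"
    proof -
      have c: "fps_const (3 :: int) = 3"
        by (simp add: fps_numeral_fps_const)
      show ?thesis
        unfolding c power2_eq_square power3_eq_cube by (simp add: algebra_simps)
    qed
    have "(fps_X ^ 3 :: int fps) ^ k = (fps_X ^ k) ^ 3"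
      unfolding power_mult[symmetric] by (simp only: mult.commute)
    thus "1 - (fps_X ^ 3) ^ k =
        (1 - fps_X ^ k) * ((1 - fps_X ^ k)\<^sup>2 + fps_const 3 * fps_X ^ k :: int fps)"
      by (simp only: *)
  qed auto
  also have "agree M \<dots> (euler *
      (\<Prod>k=1..2*M. (1 - fps_X ^ k)\<^sup>2 + fps_const 3 * fps_X ^ k :: int fps))"
    by (intro agree_mult agree_refl agree_qpoch_euler) auto
  also have "(\<Prod>k=1..2*M. (1 - fps_X ^ k)\<^sup>2 + fps_const 3 * fps_X ^ k :: int fps) =
      (\<Sum>n\<le>2*M. jtp_coeff fps_X (2*M) n * Wpoly (fps_const 3) n)"
    by (rule prod_eq_sum_Wpoly)
  also have "agree M (euler * (\<Sum>n\<le>2*M. jtp_coeff fps_X (2*M) n * Wpoly (fps_const 3) n))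
               (triseries (\<lambda>n. (-1) ^ n * Wpoly 3 n))"
    unfolding Wpoly_fps_const by (rule agree_triseries) auto
  finally show "agree M euler3 (triseries (\<lambda>n. (-1) ^ n * Wpoly 3 n))" .
qed

section \<open>MacMahon's series\<close>

definition MO_factor :: "nat \<Rightarrow> int fps" where
  "MO_factor k = fps_X ^ k * fps_right_inverse ((1 - fps_X ^ k)\<^sup>2) 1"

lemma MO_factor: "k > 0 \<Longrightarrow> (1 - fps_X ^ k)\<^sup>2 * MO_factor k = fps_X ^ k"
  using fps_right_inverse[of "(1 - fps_X ^ k)\<^sup>2 :: int fps" 1]
  by (simp add: MO_factor_def mult.left_commute fps_nth_power_0 zero_power)

lemma fps_right_inverse_mult:
  fixes f g :: "'a::comm_ring_1 fps"
  assumes "fps_nth f 0 = 1" "fps_nth g 0 = 1"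
  shows   "fps_right_inverse (f * g) 1 = fps_right_inverse f 1 * fps_right_inverse g 1"
proof -
  let ?i = "\<lambda>f. fps_right_inverse f 1"
  have f: "f * ?i f = 1" and g: "g * ?i g = 1" and fg: "(f * g) * ?i (f * g) = 1"
    using assms by (simp_all add: fps_right_inverse)
  have "?i (f * g) = (f * ?i f) * (g * ?i g) * ?i (f * g)"
    unfolding f g by simp
  also have "\<dots> = ?i f * ?i g * ((f * g) * ?i (f * g))"
    by (simp add: mult_ac)
  also have "\<dots> = ?i f * ?i g"
    unfolding fg by simp
  finally show ?thesis .
qed

lemma MO_denom_nth_0: "\<forall>k\<in>set ks. 0 < k \<Longrightarrow> fps_nth (MO_denom ks) 0 = 1"
  by (induction ks) (auto simp: MO_denom_def fps_nth_power_0 power2_eq_square zero_power)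

lemma MO_summand_eq_prod_list:
  "\<forall>k\<in>set ks. 0 < k \<Longrightarrow> MO_summand ks = (\<Prod>k\<leftarrow>ks. MO_factor k)"
proof (induction ks)
  case Nil
  have "fps_right_inverse (1 :: int fps) 1 = 1"
    using fps_right_inverse[of "1 :: int fps" 1] by simp
  thus ?case by (simp add: MO_summand_def MO_denom_def)
next
  case (Cons k ks)
  have *: "fps_right_inverse (MO_denom (k # ks)) 1 =
        fps_right_inverse ((1 - fps_X ^ k)\<^sup>2) 1 * fps_right_inverse (MO_denom ks) 1"
    using fps_right_inverse_mult[of "(1 - fps_X ^ k)\<^sup>2" "MO_denom ks"] Cons.prems
      MO_denom_nth_0[of ks]
    by (simp add: MO_denom_def fps_nth_power_0 zero_power)
  have "MO_summand (k # ks) = MO_factor k * MO_summand ks"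
    unfolding MO_summand_def * MO_factor_def by (simp add: power_add mult_ac)
  thus ?case using Cons by simp
qed

section \<open>Truncation to tuples with bounded entries\<close>

definition bounded_tuples :: "nat \<Rightarrow> nat \<Rightarrow> nat list set" where
  "bounded_tuples N a = {ks \<in> increasing_tuples a. set ks \<subseteq> {..N}}"

lemma finite_bounded_tuples: "finite (bounded_tuples N a)"
  by (rule finite_subset[of _ "{ks. set ks \<subseteq> {..N} \<and> length ks = a}"])
     (auto simp: bounded_tuples_def increasing_tuples_def finite_lists_length_eq)

lemma bounded_tuples_0_right: "bounded_tuples N 0 = {[]}"
  by (auto simp: bounded_tuples_def increasing_tuples_def)

lemma bounded_tuples_0_left: "bounded_tuples 0 (Suc a) = {}"
  by (auto simp: bounded_tuples_def increasing_tuples_def length_Suc_conv)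

text \<open>Case distinction on whether the last, hence largest, entry is N+1.\<close>

lemma bounded_tuples_Suc_Suc:
  "bounded_tuples (Suc N) (Suc a) =
     bounded_tuples N (Suc a) \<union> (\<lambda>ks. ks @ [Suc N]) ` bounded_tuples N a"
proof (intro Set.equalityI subsetI)
  fix ks assume ks: "ks \<in> bounded_tuples (Suc N) (Suc a)"
  then obtain ls k where ls: "ks = ls @ [k]"
    by (cases ks rule: rev_cases) (auto simp: bounded_tuples_def increasing_tuples_def)
  have *: "length ls = a" "sorted_wrt (<) ls" "\<forall>l\<in>set ls. 0 < l \<and> l < k" "0 < k" "k \<le> Suc N"
    using ks by (auto simp: ls bounded_tuples_def increasing_tuples_def sorted_wrt_append)
  show "ks \<in> bounded_tuples N (Suc a) \<union> (\<lambda>ks. ks @ [Suc N]) ` bounded_tuples N a"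
  proof (cases "k = Suc N")
    case True
    hence "ls \<in> bounded_tuples N a"
      using * by (auto simp: bounded_tuples_def increasing_tuples_def)
    thus ?thesis using ls True by blast
  next
    case False
    hence "k \<le> N" using * by simp
    moreover have "l \<le> N" if "l \<in> set ls" for l
      using that * \<open>k \<le> N\<close> by (meson dual_order.trans less_imp_le)
    ultimately show ?thesis
      using ks by (auto simp: bounded_tuples_def ls)
  qed
qed (fastforce simp: bounded_tuples_def increasing_tuples_def sorted_wrt_append)

definition MO_trunc :: "nat \<Rightarrow> nat \<Rightarrow> int fps" where
  "MO_trunc N a = (\<Sum>ks\<in>bounded_tuples N a. MO_summand ks)"

lemma MO_trunc_Suc_Suc:
  "MO_trunc (Suc N) (Suc a) = MO_trunc N (Suc a) + MO_factor (Suc N) * MO_trunc N a"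
proof -
  have "MO_trunc (Suc N) (Suc a) = MO_trunc N (Suc a) +
          (\<Sum>ks\<in>(\<lambda>ks. ks @ [Suc N]) ` bounded_tuples N a. MO_summand ks)"
    unfolding MO_trunc_def bounded_tuples_Suc_Suc
  proof (intro sum.union_disjoint finite_imageI finite_bounded_tuples)
    show "bounded_tuples N (Suc a) \<inter> (\<lambda>ks. ks @ [Suc N]) ` bounded_tuples N a = {}"
      by (auto simp: bounded_tuples_def)
  qed
  also have "(\<Sum>ks\<in>(\<lambda>ks. ks @ [Suc N]) ` bounded_tuples N a. MO_summand ks) =
             (\<Sum>ks\<in>bounded_tuples N a. MO_summand (ks @ [Suc N]))"
    by (subst sum.reindex) (auto simp: inj_on_def)
  also have "\<dots> = (\<Sum>ks\<in>bounded_tuples N a. MO_factor (Suc N) * MO_summand ks)"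
    by (intro sum.cong refl)
       (auto simp: bounded_tuples_def increasing_tuples_def MO_summand_eq_prod_list ball_Un mult.commute)
  finally show ?thesis
    by (simp add: MO_trunc_def sum_distrib_left)
qed

lemma MO_trunc_0_right: "MO_trunc N 0 = 1"
  by (simp add: MO_trunc_def bounded_tuples_0_right MO_summand_eq_prod_list)

lemma MO_trunc_0_left: "MO_trunc 0 (Suc a) = 0"
  by (simp add: MO_trunc_def bounded_tuples_0_left)

text \<open>\<open>MO_trunc N a\<close> is the a-th elementary symmetric polynomial in
  \<open>MO_factor 1\<close>, ..., \<open>MO_factor N\<close>; splitting off the largest entry
  matches multiplying by one more linear factor.\<close>

lemma coeff_prod_MO_factor:
  "coeff (\<Prod>k=1..N. [:1, MO_factor k:]) a = MO_trunc N a"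
proof (induction N arbitrary: a)
  case 0
  show ?case by (cases a) (simp_all add: MO_trunc_0_left MO_trunc_0_right)
next
  case (Suc N)
  show ?case
    using Suc
    by (cases a) (simp_all add: MO_trunc_0_right MO_trunc_Suc_Suc coeff_pCons mult.commute[of _ "[:_, _:]"])
qed

text \<open>A summand is divisible by X to the sum of its tuple, so a tuple with an entry above N
  contributes nothing up to degree M.\<close>

lemma agree_MO_trunc:
  assumes "N \<ge> M"
  shows   "agree M (MO_trunc N a) (MO_gf a)"
  unfolding agree_def
proof safe
  fix m assume "m \<le> M"
  have "(MO_summand has_sum MO_gf a) (increasing_tuples a)"
    unfolding MO_gf_def using MO_summable by simp
  hence "fps_nth (MO_gf a) m = (\<Sum>ks | ks \<in> increasing_tuples a \<and> fps_nth (MO_summand ks) m \<noteq> 0.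
             fps_nth (MO_summand ks) m)"
    by (rule has_sum_fpsD)
  also have "\<dots> = (\<Sum>ks\<in>bounded_tuples N a. fps_nth (MO_summand ks) m)"
  proof (rule sum.mono_neutral_left)
    show "{ks. ks \<in> increasing_tuples a \<and> fps_nth (MO_summand ks) m \<noteq> 0} \<subseteq> bounded_tuples N a"
    proof safe
      fix ks assume ks: "ks \<in> increasing_tuples a" "fps_nth (MO_summand ks) m \<noteq> 0"
      hence "sum_list ks \<le> m"
        by (auto simp: MO_summand_def fps_X_power_mult_nth split: if_splits)
      hence "k \<le> N" if "k \<in> set ks" for k
        using member_le_sum_list[OF that] assms \<open>m \<le> M\<close> by linarith
      thus "ks \<in> bounded_tuples N a"
        using ks by (auto simp: bounded_tuples_def)
    qed
  qed (use finite_bounded_tuples in \<open>simp_all add: bounded_tuples_def\<close>)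
  finally show "fps_nth (MO_trunc N a) m = fps_nth (MO_gf a) m"
    by (simp add: MO_trunc_def fps_sum_nth)
qed

section \<open>Comparing coefficients of \<open>x^a\<close>\<close>

lemma jtp_coeff_const_poly: "jtp_coeff [:q:] N n = [:jtp_coeff q N n:]"
proof -
  show ?thesis
    by (induction q N n rule: jtp_coeff.induct)
       (simp_all add: jtp_coeff.simps poly_const_pow one_pCons mult_ac flip: pCons_one)
qed

text \<open>The coefficient of $x^a$ in $W_n$.\<close>
definition Wcoeff :: "nat \<Rightarrow> nat \<Rightarrow> int" where
  "Wcoeff n a = (-1) ^ a * int ((n + a + 1 choose (2 * a + 1)) + (n + a choose (2 * a + 1)))"

lemma Wcoeff_Suc_Suc_0: "Wcoeff (Suc (Suc n)) 0 = 2 * Wcoeff (Suc n) 0 - Wcoeff n 0"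
  by (simp add: Wcoeff_def)

text \<open>The second difference in m of the binomial of m over 2a+3 is the binomial of m over
  2a+1, which mirrors W_(n+2) - 2 W_(n+1) + W_n = - x W_(n+1).\<close>

lemma Wcoeff_Suc_Suc_Suc:
  "Wcoeff (Suc (Suc n)) (Suc a) = 2 * Wcoeff (Suc n) (Suc a) - Wcoeff (Suc n) a - Wcoeff n (Suc a)"
  by (simp add: Wcoeff_def algebra_simps)

lemma coeff_Wpoly: "coeff (Wpoly [:0, 1:] n) a = of_int (Wcoeff n a)"
proof (induction "[:0, 1:] :: 'a poly" n arbitrary: a rule: Wpoly.induct)
  case 1
  have 0: "n choose Suc (2 * n) = 0" "n choose Suc (Suc (2 * n)) = 0"
     "n choose Suc (Suc (Suc (2 * n))) = 0" for n :: nat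
    by (simp_all add: binomial_eq_0)
  show ?case by (cases a) (simp_all add: Wcoeff_def 0)
next
  case 2
  have 0: "n choose Suc (2 * n) = 0" "n choose Suc (Suc (2 * n)) = 0"
     "n choose Suc (Suc (Suc (2 * n))) = 0" for n :: nat
    by (simp_all add: binomial_eq_0)
  have "3 - [:0, 1:] = [:3, -1 :: 'a:]"
    by (simp add: numeral_poly)
  thus ?case by (cases a) (simp_all add: Wcoeff_def 0 coeff_pCons split: nat.split)
next
  case (3 n)
  have *: "2 - [:0, 1:] = [:2, -1 :: 'a:]"
    by (simp add: numeral_poly)
  show ?case
    by (cases a) (simp_all add: * 3 coeff_diff Wcoeff_Suc_Suc_0 Wcoeff_Suc_Suc_Suc)
qed

text \<open>Apply \<open>prod_eq_sum_Wpoly\<close> over polynomials in the indeterminate x with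
  power series coefficients. Each factor is (1 - q^k)^2 (1 + x \<open>MO_factor k\<close>), so x^a
  carries the truncated series times a squared partial product; the third factor
  \<open>euler\<close> removes the Gaussian binomials in the limit.\<close>

lemma euler_cube_mult_MO_gf: "euler ^ 3 * MO_gf a = triseries (\<lambda>n. (-1) ^ n * Wcoeff n a)"
proof (rule fps_eqI_agree)
  fix M :: nat
  define N where "N = 2 * M"
  have "agree M (euler ^ 3 * MO_gf a) (euler * (qpoch fps_X N ^ 2 * MO_trunc N a))"
    unfolding power3_eq_cube power2_eq_square mult.assoc
    by (intro agree_mult agree_refl agree_sym[OF agree_qpoch_euler] agree_sym[OF agree_MO_trunc])
       (auto simp: N_def)
  also have "qpoch fps_X N ^ 2 * MO_trunc N a =
      coeff (\<Prod>k=1..N. (1 - [:fps_X:] ^ k)\<^sup>2 + [:0, 1:] * [:fps_X:] ^ k :: int fps poly) a"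
  proof -
    have "(\<Prod>k=1..N. (1 - [:fps_X:] ^ k)\<^sup>2 + [:0, 1:] * [:fps_X:] ^ k :: int fps poly) =
          (\<Prod>k=1..N. [:(1 - fps_X ^ k)\<^sup>2:] * [:1, MO_factor k:])"
    proof (rule prod.cong)
      fix k assume "k \<in> {1..N}"
      thus "(1 - [:fps_X:] ^ k)\<^sup>2 + [:0, 1:] * [:fps_X:] ^ k = [:(1 - fps_X ^ k)\<^sup>2:] * [:1, MO_factor k:]"
        using MO_factor[of k] by (simp add: poly_const_pow one_pCons mult.commute flip: pCons_one)
    qed auto
    also have "\<dots> = [:qpoch fps_X N ^ 2:] * (\<Prod>k=1..N. [:1, MO_factor k:])"
    proof -
      have "(\<Prod>k=1..N. [:(1 - fps_X ^ k)\<^sup>2:]) = [:qpoch fps_X N ^ 2 :: int fps:]"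
        by (induction N) (simp_all add: qpoch_Suc qpoch_def power_mult_distrib mult.commute flip: pCons_one)
      thus ?thesis unfolding prod.distrib by simp
    qed
    finally show ?thesis by (simp only: coeff_prod_MO_factor[symmetric]) simp
  qed
  also have "(\<Prod>k=1..N. (1 - [:fps_X:] ^ k)\<^sup>2 + [:0, 1:] * [:fps_X:] ^ k :: int fps poly) =
      (\<Sum>n\<le>N. jtp_coeff [:fps_X:] N n * Wpoly [:0, 1:] n)"
    by (rule prod_eq_sum_Wpoly)
  also have "coeff (\<Sum>n\<le>N. jtp_coeff [:fps_X:] N n * Wpoly [:0, 1:] n) a =
        (\<Sum>n\<le>N. jtp_coeff fps_X N n * fps_const (Wcoeff n a))"
  proof -
    have "fps_const c = of_int c" for c :: int
      using fps_of_int[of c, where 'a = int] by simp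
    thus ?thesis
      by (simp add: coeff_sum jtp_coeff_const_poly coeff_Wpoly)
  qed
  also have "agree M (euler * \<dots>) (triseries (\<lambda>n. (-1) ^ n * Wcoeff n a))"
    by (rule agree_triseries) (auto simp: N_def)
  finally show "agree M (euler ^ 3 * MO_gf a) (triseries (\<lambda>n. (-1) ^ n * Wcoeff n a))" .
qed

section \<open>Generating functions with integer indices\<close>

text \<open>The condition under which the terms w(x) q^(e x), with x ranging over A, have a
  well-defined sum as a power series.\<close>

definition admissible :: "'i set \<Rightarrow> ('i \<Rightarrow> int) \<Rightarrow> bool" where
  "admissible A e \<longleftrightarrow> (\<forall>x\<in>A. 0 \<le> e x) \<and> (\<forall>N. finite {x\<in>A. e x = N})"

text \<open>The sum of w(x) q^(e x) over A. An infinite fibre would count as 0 by the default of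
  \<open>sum\<close>, and negative exponents would be dropped; \<open>admissible\<close> excludes
  both.\<close>

definition zgf :: "'i set \<Rightarrow> ('i \<Rightarrow> int) \<Rightarrow> ('i \<Rightarrow> int) \<Rightarrow> int fps" where
  "zgf A e w = Abs_fps (\<lambda>n. \<Sum>x | x \<in> A \<and> e x = int n. w x)"

lemma admissible_inj:
  assumes "admissible B f" "inj_on h A" "\<And>x. x \<in> A \<Longrightarrow> h x \<in> B" "\<And>x. x \<in> A \<Longrightarrow> e x = f (h x)"
  shows   "admissible A e"
  unfolding admissible_def
proof safe
  fix N
  have "finite (h ` {x\<in>A. e x = N})"
    by (rule finite_subset[of _ "{y\<in>B. f y = N}"]) (use assms in \<open>auto simp: admissible_def\<close>)
  thus "finite {x\<in>A. e x = N}"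
    by (rule finite_imageD) (rule inj_on_subset[OF assms(2)], auto)
qed (use assms in \<open>auto simp: admissible_def\<close>)

lemma admissible_times:
  assumes "admissible A e" "admissible B f"
  shows   "admissible (A \<times> B) (\<lambda>(x, y). e x + f y)"
  unfolding admissible_def
proof safe
  fix N
  show "finite {z \<in> A \<times> B. (case z of (x, y) \<Rightarrow> e x + f y) = N}"
  proof (rule finite_subset)
    show "{z \<in> A \<times> B. (case z of (x, y) \<Rightarrow> e x + f y) = N} \<subseteq>
            (\<Union>i\<in>{0..N}. {x\<in>A. e x = i} \<times> {y\<in>B. f y = N - i})"
    proof (rule subsetI)
      fix z assume "z \<in> {z \<in> A \<times> B. (case z of (x, y) \<Rightarrow> e x + f y) = N}"
      then obtain x y where z: "z = (x, y)" "x \<in> A" "y \<in> B" "e x + f y = N" by auto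
      moreover from this have "e x \<ge> 0" "f y \<ge> 0" using assms by (auto simp: admissible_def)
      ultimately show "z \<in> (\<Union>i\<in>{0..N}. {x\<in>A. e x = i} \<times> {y\<in>B. f y = N - i})"
        by (intro UN_I[of "e x"]) auto
    qed
  qed (use assms in \<open>auto simp: admissible_def\<close>)
qed (use assms in \<open>auto simp: admissible_def\<close>)

lemma zgf_mult:
  assumes "admissible A e" "admissible B f"
  shows   "zgf A e w * zgf B f v = zgf (A \<times> B) (\<lambda>(x, y). e x + f y) (\<lambda>(x, y). w x * v y)"
proof (rule fps_ext)
  fix n
  define S where "S = (\<lambda>i. {x\<in>A. e x = int i})"
  define T where "T = (\<lambda>i. {y\<in>B. f y = int i})"
  have fin: "finite (S i)" "finite (T i)" for i
    using assms by (auto simp: S_def T_def admissible_def)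
  have "fps_nth (zgf A e w * zgf B f v) n = (\<Sum>i=0..n. (\<Sum>x\<in>S i. w x) * (\<Sum>y\<in>T (n - i). v y))"
    by (simp add: fps_mult_nth zgf_def S_def T_def)
  also have "\<dots> = (\<Sum>i=0..n. \<Sum>z\<in>S i \<times> T (n - i). case z of (x, y) \<Rightarrow> w x * v y)"
    by (simp add: sum_product sum.cartesian_product)
  also have "\<dots> = (\<Sum>z\<in>(\<Union>i\<in>{0..n}. S i \<times> T (n - i)). case z of (x, y) \<Rightarrow> w x * v y)"
    by (rule sum.UNION_disjoint[symmetric]) (auto simp: fin, auto simp: S_def)
  also have "(\<Union>i\<in>{0..n}. S i \<times> T (n - i)) = {z. z \<in> A \<times> B \<and> (case z of (x, y) \<Rightarrow> e x + f y) = int n}"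
  proof (intro Set.equalityI subsetI)
    fix z assume "z \<in> {z. z \<in> A \<times> B \<and> (case z of (x, y) \<Rightarrow> e x + f y) = int n}"
    then obtain x y where z: "z = (x, y)" "x \<in> A" "y \<in> B" "e x + f y = int n" by auto
    moreover from this have "e x \<ge> 0" "f y \<ge> 0" using assms by (auto simp: admissible_def)
    ultimately show "z \<in> (\<Union>i\<in>{0..n}. S i \<times> T (n - i))"
      by (intro UN_I[of "nat (e x)"]) (auto simp: S_def T_def)
  qed (auto simp: S_def T_def)
  finally show "fps_nth (zgf A e w * zgf B f v) n =
      fps_nth (zgf (A \<times> B) (\<lambda>(x, y). e x + f y) (\<lambda>(x, y). w x * v y)) n"
    by (simp add: zgf_def)
qed

lemma zgf_reindex:
  assumes "\<And>x. x \<in> A \<Longrightarrow> h x \<in> B" "\<And>x. x \<in> A \<Longrightarrow> g (h x) = x"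
    and "\<And>y. y \<in> B \<Longrightarrow> g y \<in> A" "\<And>y. y \<in> B \<Longrightarrow> h (g y) = y"
    and "\<And>x. x \<in> A \<Longrightarrow> f (h x) = e x" "\<And>x. x \<in> A \<Longrightarrow> v (h x) = w x"
  shows   "zgf A e w = zgf B f v"
  unfolding zgf_def
  by (intro arg_cong[of _ _ Abs_fps] ext sum.reindex_bij_witness[of _ g h])
     (use assms in \<open>auto\<close>, metis)

lemma zgf_add: "zgf A e (\<lambda>x. w x + v x) = zgf A e w + zgf A e v"
  by (simp add: zgf_def fps_eq_iff sum.distrib)

lemma zgf_uminus: "zgf A e (\<lambda>x. -w x) = -zgf A e w"
  by (simp add: zgf_def fps_eq_iff sum_negf)

lemma zgf_cmult: "zgf A e (\<lambda>x. c * w x) = fps_const c * zgf A e w"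
  by (simp add: zgf_def fps_eq_iff sum_distrib_left)

lemma zgf_Un_disjoint:
  assumes "admissible (A \<union> B) e" "A \<inter> B = {}"
  shows   "zgf (A \<union> B) e w = zgf A e w + zgf B e w"
proof (rule fps_ext)
  fix n
  have fin: "finite {x\<in>A \<union> B. e x = int n}"
    using assms(1) by (auto simp: admissible_def)
  have "{x. x \<in> A \<union> B \<and> e x = int n} = {x\<in>A. e x = int n} \<union> {x\<in>B. e x = int n}"
    by auto
  thus "fps_nth (zgf (A \<union> B) e w) n = fps_nth (zgf A e w + zgf B e w) n"
    using assms(2) fin by (simp add: zgf_def) (subst sum.union_disjoint; auto)
qed

text \<open>Sign-reversing involution: the series equals its own negative. At fixed points the
  weight is 0.\<close>

lemma zgf_eq_0:
  assumes "\<And>x. x \<in> A \<Longrightarrow> h x \<in> A" "\<And>x. x \<in> A \<Longrightarrow> h (h x) = x"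
    and "\<And>x. x \<in> A \<Longrightarrow> e (h x) = e x" "\<And>x. x \<in> A \<Longrightarrow> w (h x) = -w x"
  shows   "zgf A e w = 0"
proof -
  have "zgf A e w = zgf A e (\<lambda>x. -w x)"
    by (rule zgf_reindex[of A h A h]) (use assms in auto)
  also have "\<dots> = -zgf A e w"
    by (rule zgf_uminus)
  finally have "fps_nth (zgf A e w) n = - fps_nth (zgf A e w) n" for n
    by (metis fps_neg_nth)
  hence "fps_nth (zgf A e w) n = 0" for n
    by (smt (verit))
  thus ?thesis
    by (simp add: fps_eq_iff)
qed

section \<open>Bilateral series over triangular and pentagonal numbers\<close>

definition tri :: "int \<Rightarrow> int" where "tri n = n * (n - 1) div 2"

definition sg :: "int \<Rightarrow> int" where "sg n = (if even n then 1 else -1)"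

lemma two_tri: "2 * tri n = n * (n - 1)"
  by (simp add: tri_def)

lemma sg_simps: "sg (a + b) = sg a * sg b" "sg (a - b) = sg a * sg b" "sg (-a) = sg a" "sg 1 = -1"
    "sg 0 = 1"
  by (simp_all add: sg_def)

text \<open>A linear bound that makes the fibres of \<open>tri\<close> finite. Doubled, the
  difference of the sides is (n-1)(n-2) for n \<ge> 1 and n(n+1) + 2 for n \<le> 0.\<close>

lemma tri_ge_abs: "\<bar>n\<bar> - 1 \<le> tri n"
proof -
  have "2 * (\<bar>n\<bar> - 1) \<le> n * (n - 1)"
  proof (cases "n \<ge> 1")
    case True
    have "0 \<le> (n - 1) * (n - 2)"
      using True by (cases "n = 1") auto
    thus ?thesis using True by (simp add: algebra_simps)
  next
    case False
    have "0 \<le> n * (n + 1)"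
      using False by (cases "n = 0") (simp_all add: mult_nonpos_nonpos)
    thus ?thesis using False by (simp add: algebra_simps)
  qed
  thus ?thesis unfolding two_tri[symmetric] by simp
qed

lemma tri_nonneg: "0 \<le> tri n"
  using tri_ge_abs[of n] by (cases "n = 0") (auto simp: tri_def)

lemma admissible_tri: "admissible UNIV tri"
  unfolding admissible_def
proof safe
  fix N
  have "n \<in> {-(N + 1)..N + 1}" if "tri n = N" for n
    using tri_ge_abs[of n] unfolding that atLeastAtMost_iff by linarith
  thus "finite {n \<in> UNIV. tri n = N}"
    by (intro finite_subset[of "{n \<in> UNIV. tri n = N}" "{-(N + 1)..N + 1}"] subsetI) simp_all
qed (rule tri_nonneg)

lemma tri_of_nat: "tri (int n + 1) = int (Suc n choose 2)" "tri (- int n) = int (Suc n choose 2)"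
proof -
  have "2 * int (Suc n choose 2) = (int n + 1) * int n"
    by (induction n) (simp_all add: numeral_2_eq_2 algebra_simps)
  thus "tri (int n + 1) = int (Suc n choose 2)" "tri (- int n) = int (Suc n choose 2)"
    using two_tri[of "int n + 1"] two_tri[of "- int n"] by (simp_all add: algebra_simps)
qed

lemma triseries_eq_zgf: "triseries c = zgf UNIV (\<lambda>n. int (Suc n choose 2)) c"
proof (rule fps_ext)
  fix m
  have "fps_nth (triseries c) m = (\<Sum>n\<in>{n\<in>{..m}. Suc n choose 2 = m}. c n)"
    unfolding triseries_def fps_nth_Abs_fps by (rule sum.inter_filter[symmetric]) simp
  also have "{n\<in>{..m}. Suc n choose 2 = m} = {n. Suc n choose 2 = m}"
    using le_Suc_choose_two by auto
  finally show "fps_nth (triseries c) m = fps_nth (zgf UNIV (\<lambda>n. int (Suc n choose 2)) c) m"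
    by (simp add: zgf_def)
qed

text \<open>Folding: the indices n+1 and -n share the triangular number n(n+1)/2, and they exhaust
  the integers.\<close>

lemma zgf_tri: "zgf UNIV tri w = triseries (\<lambda>n. w (int n + 1) + w (- int n))"
proof -
  have UN: "(UNIV :: int set) = {1..} \<union> {..0}" by auto
  have "zgf UNIV tri w = zgf {1..} tri w + zgf {..0} tri w"
    unfolding UN by (rule zgf_Un_disjoint) (use admissible_tri UN in auto)
  also have "zgf {1..} tri w = zgf UNIV (\<lambda>n. int (Suc n choose 2)) (\<lambda>n. w (int n + 1))"
    by (rule zgf_reindex[of _ "\<lambda>k. nat (k - 1)" _ "\<lambda>n. int n + 1"])
       (auto simp: tri_of_nat(1)[symmetric] simp del: binomial_Suc_Suc)
  also have "zgf {..0} tri w = zgf UNIV (\<lambda>n. int (Suc n choose 2)) (\<lambda>n. w (- int n))"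
    by (rule zgf_reindex[of _ "\<lambda>k. nat (- k)" _ "\<lambda>n. - int n"])
       (auto simp: tri_of_nat(2)[symmetric] simp del: binomial_Suc_Suc)
  finally show ?thesis
    by (simp only: zgf_add triseries_eq_zgf)
qed

lemma zgf_tri_sg: "zgf UNIV tri (\<lambda>n. sg n * n) = - (euler ^ 3)"
proof -
  have sg: "sg (int n) = (-1) ^ n" for n by (simp add: sg_def)
  have "zgf UNIV tri (\<lambda>n. sg n * n) = triseries (\<lambda>n. -((-1) ^ n * (2 * int n + 1)))"
    unfolding zgf_tri by (rule arg_cong[of _ _ triseries]) (auto simp: sg_simps sg algebra_simps)
  also have "\<dots> = - (euler ^ 3)"
    unfolding euler_cube triseries_eq_zgf by (rule zgf_uminus)
  finally show ?thesis .
qed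

text \<open>At x = 3 the recursion reads W_(n+2) = - W_(n+1) - W_n, so the values repeat 1, 0,
  -1.\<close>

lemma Wpoly_3: "Wpoly (3 :: int) n = (if n mod 3 = 0 then 1 else if n mod 3 = 1 then 0 else -1)"
proof (induction n rule: less_induct)
  case (less n)
  consider "n = 0" | "n = 1" | m where "n = Suc (Suc m)"
    by (metis One_nat_def old.nat.exhaust)
  thus ?case
  proof cases
    case (3 m)
    hence "Wpoly (3 :: int) n = - Wpoly 3 (Suc m) - Wpoly 3 m" by simp
    also have "\<dots> = (if n mod 3 = 0 then 1 else if n mod 3 = 1 then 0 else -1)"
      unfolding less[of "Suc m", unfolded 3, simplified] less[of m, unfolded 3, simplified] 3
      by (simp; presburger)
    finally show ?thesis .
  qed auto
qed

text \<open>The generalized pentagonal numbers. They are the thirds of the triangular numbers at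
  multiples of 3, see \<open>tri_3\<close>.\<close>

definition pent :: "int \<Rightarrow> int" where "pent l = l * (3 * l + 1) div 2"

lemma two_pent: "2 * pent l = l * (3 * l + 1)"
proof -
  have "even (l * (3 * l + 1))" by simp
  thus ?thesis unfolding pent_def by (rule dvd_mult_div_cancel)
qed

lemma tri_3: "tri (- 3 * l) = 3 * pent l"
  using two_tri[of "- 3 * l"] two_pent[of l] by (simp add: algebra_simps)

lemma pent_0 [simp]: "pent 0 = 0"
  by (simp add: pent_def)

lemma admissible_pent: "admissible UNIV pent"
proof -
  have "admissible UNIV (\<lambda>l. tri (-3 * l))"
    by (rule admissible_inj[OF admissible_tri, of "\<lambda>l. -3 * l"]) (auto simp: inj_on_def)
  hence *: "admissible UNIV (\<lambda>l. 3 * pent l)"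
    unfolding tri_3 .
  have "finite {l. pent l = N}" for N
  proof -
    have "finite {l \<in> UNIV. 3 * pent l = 3 * N}"
      using * unfolding admissible_def by blast
    thus ?thesis by simp
  qed
  moreover have "0 \<le> pent l" for l
    using * unfolding admissible_def by simp
  ultimately show ?thesis
    unfolding admissible_def by simp
qed

text \<open>The pentagonal number theorem. The coefficient of \<open>euler\<close> at n is that of
  \<open>euler3\<close> at 3n, and the values of \<open>Wpoly 3\<close> select exactly the multiples
  of 3 from the bilateral triangular series.\<close>

lemma euler_eq_zgf: "euler = zgf UNIV pent sg"
proof (rule fps_ext)
  fix n
  have "euler3 = zgf UNIV tri (\<lambda>k. if 3 dvd k then sg k else 0)"
    unfolding zgf_tri euler3_eq
  proof (rule arg_cong[of _ _ triseries], rule ext)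
    fix n :: nat
    have "n mod 3 = 0 \<or> n mod 3 = 1 \<or> n mod 3 = 2" by presburger
    moreover have "(3 dvd int n + 1) = (n mod 3 = 2)" "(3 dvd - int n) = (n mod 3 = 0)"
      by presburger+
    moreover have "sg (int n) = (-1) ^ n" by (simp add: sg_def)
    ultimately show "(-1) ^ n * Wpoly 3 n = (if 3 dvd int n + 1 then sg (int n + 1) else 0) +
        (if 3 dvd - int n then sg (- int n) else 0)"
      by (auto simp: Wpoly_3 sg_simps)
  qed
  hence "fps_nth euler n = fps_nth (zgf UNIV tri (\<lambda>k. if 3 dvd k then sg k else 0)) (3 * n)"
    using euler3_nth[of "3 * n"] by simp
  also have "\<dots> = (\<Sum>k | tri k = 3 * int n. if 3 dvd k then sg k else 0)"
    by (simp add: zgf_def)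
  also have "\<dots> = (\<Sum>k | tri k = 3 * int n \<and> 3 dvd k. sg k)"
  proof -
    have "finite {k. tri k = 3 * int n}" using admissible_tri by (auto simp: admissible_def)
    from sum.inter_filter[OF this, of sg "\<lambda>k. 3 dvd k"] show ?thesis by simp
  qed
  also have "\<dots> = (\<Sum>l | pent l = int n. sg l)"
  proof (rule sum.reindex_bij_witness[of _ "\<lambda>l. -3 * l" "\<lambda>k. - (k div 3)"])
    fix k assume "k \<in> {k. tri k = 3 * int n \<and> 3 dvd k}"
    then obtain l where l: "k = -3 * l" "tri k = 3 * int n"
      by (auto elim!: dvdE) (metis mult_minus_right minus_minus)
    have "k div 3 = -l" unfolding l by simp
    moreover have "pent l = int n" using l tri_3[of l] by simp
    moreover have "sg l = sg k" unfolding l by (simp add: sg_def)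
    ultimately show "-3 * - (k div 3) = k" "- (k div 3) \<in> {l. pent l = int n}"
      "sg (- (k div 3)) = sg k"
      using l by simp_all
  next
    fix l assume "l \<in> {l. pent l = int n}"
    thus "- (-3 * l div 3) = l" "-3 * l \<in> {k. tri k = 3 * int n \<and> 3 dvd k}"
      using tri_3[of l] by auto
  qed
  finally show "fps_nth euler n = fps_nth (zgf UNIV pent sg) n"
    by (simp add: zgf_def)
qed

section \<open>The eighth power of Euler's product\<close>

definition expo3 :: "int \<times> int \<times> int \<Rightarrow> int" where
  "expo3 = (\<lambda>(n, m, k). tri n + tri m + tri k)"

definition sgn3 :: "int \<times> int \<times> int \<Rightarrow> int" where
  "sgn3 = (\<lambda>(n, m, k). sg n * sg m * sg k)"

lemma admissible_expo3: "admissible UNIV expo3"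
proof -
  have "admissible (UNIV \<times> UNIV \<times> UNIV) (\<lambda>(n, y). tri n + (\<lambda>(m, k). tri m + tri k) y)"
    by (intro admissible_times admissible_tri)
  also have "(\<lambda>(n, y). tri n + (\<lambda>(m, k). tri m + tri k) y) = expo3"
    by (auto simp: expo3_def)
  finally show ?thesis by simp
qed

lemma zgf_expo3_product: "zgf UNIV expo3 (\<lambda>(n, m, k). sgn3 (n, m, k) * (n * m * k)) = - (euler ^ 9)"
proof -
  let ?t = "zgf UNIV tri (\<lambda>n. sg n * n)"
  have "?t * (?t * ?t) = zgf (UNIV \<times> UNIV \<times> UNIV) (\<lambda>(n, y). tri n + (\<lambda>(m, k). tri m + tri k) y)
          (\<lambda>(n, y). sg n * n * (\<lambda>(m, k). sg m * m * (sg k * k)) y)"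
    by (simp only: zgf_mult admissible_times admissible_tri)
  also have "(\<lambda>(n, y). tri n + (\<lambda>(m, k). tri m + tri k) y) = expo3"
    by (auto simp: expo3_def)
  also have "(\<lambda>(n, y). sg n * n * (\<lambda>(m, k). sg m * m * (sg k * k)) y) =
              (\<lambda>(n, m, k). sgn3 (n, m, k) * (n * m * k))"
    by (auto simp: sgn3_def)
  finally have "zgf UNIV expo3 (\<lambda>(n, m, k). sgn3 (n, m, k) * (n * m * k)) = ?t * (?t * ?t)"
    by simp
  also have "\<dots> = - (euler ^ 9)"
    unfolding zgf_tri_sg by (simp add: eval_nat_numeral mult_ac)
  finally show ?thesis .
qed

lemma tri_reflect: "tri (1 - n) = tri n" and sg_reflect: "sg (1 - n) = - sg n"
  by (simp_all add: tri_def sg_def algebra_simps)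

text \<open>Reflecting the variable missing from f keeps the exponent and flips the sign.\<close>

lemma zgf_expo3_indep:
  "zgf UNIV expo3 (\<lambda>(n, m, k). sgn3 (n, m, k) * f m k) = 0"
  "zgf UNIV expo3 (\<lambda>(n, m, k). sgn3 (n, m, k) * f n k) = 0"
  "zgf UNIV expo3 (\<lambda>(n, m, k). sgn3 (n, m, k) * f n m) = 0"
proof -
  show "zgf UNIV expo3 (\<lambda>(n, m, k). sgn3 (n, m, k) * f m k) = 0"
    by (rule zgf_eq_0[where h = "\<lambda>(n, m, k). (1 - n, m, k)"])
       (auto simp: expo3_def sgn3_def tri_reflect sg_reflect)
  show "zgf UNIV expo3 (\<lambda>(n, m, k). sgn3 (n, m, k) * f n k) = 0"
    by (rule zgf_eq_0[where h = "\<lambda>(n, m, k). (n, 1 - m, k)"])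
       (auto simp: expo3_def sgn3_def tri_reflect sg_reflect)
  show "zgf UNIV expo3 (\<lambda>(n, m, k). sgn3 (n, m, k) * f n m) = 0"
    by (rule zgf_eq_0[where h = "\<lambda>(n, m, k). (n, m, 1 - k)"])
       (auto simp: expo3_def sgn3_def tri_reflect sg_reflect)
qed

definition weight3 :: "int \<times> int \<times> int \<Rightarrow> int" where
  "weight3 = (\<lambda>(n, m, k). sgn3 (n, m, k) * ((n + k - 1)\<^sup>2 * (m + k - 1)))"

lemma zgf_weight3: "zgf UNIV expo3 weight3 = - 2 * euler ^ 9"
proof -
  \<comment> \<open>The expansion of the weight, grouped by the missing variable: \<open>w2\<close>
    is free of m, \<open>w3\<close> of k and \<open>w4\<close> of n; only 2nmk involves all
    three.\<close>
  define w1 where "w1 = (\<lambda>(n, m, k). sgn3 (n, m, k) * (n * m * k))"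
  define w2 where "w2 = (\<lambda>(n, m, k). sgn3 (n, m, k) * ((k - 1) * (n + k - 1)\<^sup>2))"
  define w3 where "w3 = (\<lambda>(n, m, k). sgn3 (n, m, k) * (m * n\<^sup>2 - 2 * m * n))"
  define w4 where "w4 = (\<lambda>(n, m, k). sgn3 (n, m, k) * (m * (k - 1)\<^sup>2))"
  have z: "zgf UNIV expo3 w2 = 0" "zgf UNIV expo3 w3 = 0" "zgf UNIV expo3 w4 = 0"
    unfolding w2_def w3_def w4_def by (rule zgf_expo3_indep)+
  have "weight3 x = 2 * w1 x + w2 x + w3 x + w4 x" for x
  proof -
    obtain n m k where x: "x = (n, m, k)" by (cases x)
    show ?thesis
      unfolding x weight3_def w1_def w2_def w3_def w4_def prod.case
      by (simp add: algebra_simps power2_eq_square)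
  qed
  hence "zgf UNIV expo3 weight3 = zgf UNIV expo3 (\<lambda>x. 2 * w1 x + w2 x + w3 x + w4 x)"
    by presburger
  also have "\<dots> = fps_const 2 * zgf UNIV expo3 w1"
    unfolding zgf_add zgf_cmult z by simp
  finally have "zgf UNIV expo3 weight3 = fps_const 2 * zgf UNIV expo3 w1" .
  moreover have "fps_const (2 :: int) = 2"
    unfolding fps_numeral_fps_const ..
  ultimately show ?thesis by (simp add: w1_def zgf_expo3_product)
qed

text \<open>
  With $i = n + k$ and $j = m + k$, the sum $n + m + 2k$ is $i + j$.
\<close>
definition residue3 :: "int \<Rightarrow> (int \<times> int \<times> int) set" where
  "residue3 \<rho> = {(n, m, k). (n + m + 2 * k) mod 3 = \<rho>}"

text \<open>Let i + j = 3r + 2. For fixed i and j the exponent is quadratic in k with axis r + 1/2,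
  so k -> 2r + 1 - k preserves it. The shift d is odd and changes n, m and k, so the total sign
  flips.\<close>

lemma zgf_residue3_2: "zgf (residue3 2) expo3 weight3 = 0"
proof -
  define h where "h = (\<lambda>(n, m, k).
      let d = 1 + 2 * ((n + m + 2 * k) div 3) - 2 * k in (n - d, m - d, k + d :: int))"
  have h: "h (n, m, k) = (n - d, m - d, k + d)"
    if "n + m + 2 * k = 3 * r + 2" "d = 1 + 2 * r - 2 * k" for n m k r d
    using that by (simp add: h_def Let_def)
  have *: "h x \<in> residue3 2 \<and> h (h x) = x \<and> expo3 (h x) = expo3 x \<and> weight3 (h x) = - weight3 x"
    if "x \<in> residue3 2" for x
  proof -
    obtain n m k where x: "x = (n, m, k)" by (cases x)
    hence "(n + m + 2 * k) mod 3 = 2"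
      using that by (auto simp: residue3_def)
    then obtain r where r: "n + m + 2 * k = 3 * r + 2"
      by (metis mult_div_mod_eq)
    define d where "d = 1 + 2 * r - 2 * k"
    have n: "n = 3 * r + 2 - m - 2 * k" using r by simp
    have s: "n - d + (m - d) + 2 * (k + d) = 3 * r + 2" using r by simp
    have hx: "h x = (n - d, m - d, k + d)"
      unfolding x by (rule h[OF r d_def])
    have hhx: "h (h x) = (n - d - (- d), m - d - (- d), k + d + (- d))"
      unfolding hx by (rule h[OF s]) (simp add: d_def)
    have "2 * expo3 (h x) = 2 * expo3 x"
      unfolding hx unfolding x expo3_def prod.case distrib_left two_tri d_def n
      by (simp add: algebra_simps)
    moreover have "sg d = -1" by (simp add: d_def sg_def)
    hence "weight3 (h x) = - weight3 x"
      unfolding hx unfolding x weight3_def sgn3_def prod.case sg_simps by simp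
    moreover have "h x \<in> residue3 2"
      unfolding hx residue3_def using s by simp
    moreover have "h (h x) = x"
      unfolding hhx by (simp add: x)
    ultimately show ?thesis by simp
  qed
  show ?thesis
    by (rule zgf_eq_0[where h = h]) (use * in auto)
qed

text \<open>The polynomial Q(i,j) in the coordinates r and i, with j = 3r + \<rho> - i: the value of
  \<open>expo3\<close> at k = r.\<close>

definition qexp :: "int \<Rightarrow> int \<times> int \<Rightarrow> int" where
  "qexp \<rho> = (\<lambda>(r, i). i\<^sup>2 - 3 * r * i + 3 * r\<^sup>2 - (1 - 2 * \<rho>) * r - \<rho> * i)"

text \<open>The weight (i-1)^2 (j-1) in these coordinates. For \<rho> in {0, 1} the factor 1 -
  2\<rho> is the sign of the triple at k = r.\<close>

definition qweight :: "int \<Rightarrow> int \<times> int \<Rightarrow> int" where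
  "qweight \<rho> = (\<lambda>(r, i). (1 - 2 * \<rho>) * ((i - 1)\<^sup>2 * (3 * r + \<rho> - i - 1)))"

text \<open>
  The parametrisation $i + j = 3r + \rho$, $k = r \pm l$ of the triples in \<^term>\<open>residue3 \<rho>\<close>, with the sign
  chosen such that the exponent in $l$ is always the pentagonal number $l(3l+1)/2$.
\<close>
definition unfold3 :: "int \<Rightarrow> (int \<times> int) \<times> int \<Rightarrow> int \<times> int \<times> int" where
  "unfold3 \<rho> = (\<lambda>((r, i), l). let k = r + (1 - 2 * \<rho>) * l in (i - k, 3 * r + \<rho> - i - k, k))"

text \<open>For fixed i and j the exponent is quadratic in k with leading coefficient 3/2 and vertex
  r - 1/6 or r + 1/6 for \<rho> = 0 or 1, which gives l(3l+1)/2 above its value at l = 0.\<close>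

lemma expo3_unfold3:
  assumes "\<rho> \<in> {0, 1}"
  shows   "expo3 (unfold3 \<rho> (x, l)) = qexp \<rho> x + pent l"
proof -
  obtain r i where x: "x = (r, i)" by (cases x)
  have "2 * expo3 (unfold3 \<rho> (x, l)) = 2 * qexp \<rho> x + 2 * pent l"
    using assms unfolding expo3_def unfold3_def Let_def prod.case distrib_left two_tri two_pent qexp_def x
    by (auto simp add: algebra_simps power2_eq_square)
  thus ?thesis by simp
qed

lemma weight3_unfold3:
  assumes "\<rho> \<in> {0, 1}"
  shows   "weight3 (unfold3 \<rho> (x, l)) = qweight \<rho> x * sg l"
proof -
  obtain r i where x: "x = (r, i)" by (cases x)
  define k where "k = r + (1 - 2 * \<rho>) * l"
  have *: "sg (i - k) * sg (3 * r + \<rho> - i - k) * sg k = (1 - 2 * \<rho>) * sg l"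
    using assms by (auto simp: sg_def k_def)
  have "weight3 (unfold3 \<rho> (x, l)) =
      sg (i - k) * sg (3 * r + \<rho> - i - k) * sg k * ((i - 1)\<^sup>2 * (3 * r + \<rho> - i - 1))"
    by (simp add: x weight3_def sgn3_def unfold3_def Let_def k_def)
  thus ?thesis
    unfolding * by (simp add: qweight_def x)
qed

text \<open>The slice l = 0 embeds the pairs (r, i) into the triples and turns \<open>qexp\<close>
  into \<open>expo3\<close>.\<close>

lemma admissible_qexp:
  assumes "\<rho> \<in> {0, 1}"
  shows   "admissible UNIV (qexp \<rho>)"
proof (rule admissible_inj[OF admissible_expo3, of "\<lambda>x. unfold3 \<rho> (x, 0)"])
  show "inj (\<lambda>x. unfold3 \<rho> (x, 0))"
    by (auto simp: inj_def unfold3_def)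
qed (use expo3_unfold3[OF assms, of _ 0] in auto)

text \<open>\<open>unfold3\<close> is a bijection onto the residue class that separates exponent and
  weight, and the sum over l is \<open>euler\<close> by the pentagonal number theorem.\<close>

lemma zgf_residue3:
  assumes "\<rho> \<in> {0, 1}"
  shows   "zgf (residue3 \<rho>) expo3 weight3 = zgf UNIV (qexp \<rho>) (qweight \<rho>) * euler"
proof -
  have "zgf UNIV (qexp \<rho>) (qweight \<rho>) * euler =
          zgf UNIV (\<lambda>(x, l). qexp \<rho> x + pent l) (\<lambda>(x, l). qweight \<rho> x * sg l)"
    unfolding euler_eq_zgf by (subst zgf_mult) (auto intro: admissible_qexp[OF assms] admissible_pent)
  also have "\<dots> = zgf (residue3 \<rho>) expo3 weight3"
  proof (rule zgf_reindex[where h = "unfold3 \<rho>" and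
      g = "\<lambda>(n, m, k). let r = (n + m + 2 * k) div 3 in ((r, n + k), (1 - 2 * \<rho>) * (k - r))"], goal_cases)
    case (1 x)
    show ?case using assms by (auto simp: unfold3_def residue3_def Let_def split: prod.splits)
  next
    case (2 x)
    show ?case using assms by (auto simp: unfold3_def Let_def split: prod.splits)
  next
    case (4 y)
    then obtain n m k where y: "y = (n, m, k)" and "(n + m + 2 * k) mod 3 = \<rho>"
      by (auto simp: residue3_def)
    then obtain r where r: "n + m + 2 * k = 3 * r + \<rho>"
      by (metis mult_div_mod_eq)
    have m: "m = 3 * r + \<rho> - n - 2 * k" using r by simp
    have "(3 * r + \<rho>) div 3 = r" using assms by auto
    thus ?case using assms by (auto simp: y m Let_def unfold3_def)
  qed (use expo3_unfold3[OF assms] weight3_unfold3[OF assms] in auto)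
  finally show ?thesis ..
qed

text \<open>Split the triple sum for -2 \<open>euler ^ 9\<close> by i + j modulo 3. Class 2 vanishes
  and the others contain the factor \<open>euler\<close>, which cancels in the integral
  domain.\<close>

lemma euler_power_8:
  "-2 * euler ^ 8 = zgf UNIV (qexp 0) (qweight 0) + zgf UNIV (qexp 1) (qweight 1)"
proof -
  let ?z = "\<lambda>\<rho>. zgf UNIV (qexp \<rho>) (qweight \<rho>)"
  have UN: "UNIV = residue3 0 \<union> (residue3 1 \<union> residue3 2)"
  proof -
    have "a mod 3 = 0 \<or> a mod 3 = 1 \<or> a mod 3 = 2" for a :: int by presburger
    thus ?thesis unfolding residue3_def by blast
  qed
  have adm: "admissible A expo3" for A
    by (rule admissible_inj[OF admissible_expo3, of id]) auto
  have "euler * (-2 * euler ^ 8) = zgf UNIV expo3 weight3"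
    unfolding zgf_weight3 mult.left_commute[of euler] by (simp flip: power_Suc)
  also have "\<dots> = zgf (residue3 0) expo3 weight3 + (zgf (residue3 1) expo3 weight3 + zgf (residue3 2) expo3 weight3)"
    unfolding UN by (subst zgf_Un_disjoint[OF adm]; (subst zgf_Un_disjoint[OF adm])?) (auto simp: residue3_def)
  also have "\<dots> = euler * (?z 0 + ?z 1)"
    by (simp add: zgf_residue3_2 zgf_residue3 algebra_simps)
  finally have "euler * (-2 * euler ^ 8) = euler * (?z 0 + ?z 1)" .
  moreover have "euler \<noteq> 0" using euler_nth_0 by (metis fps_zero_nth zero_neq_one)
  ultimately show ?thesis by (metis mult_left_cancel)
qed

section \<open>The quadratic exponent modulo 11\<close>

lemma square_mod_11:
  fixes a :: int
  shows "a\<^sup>2 mod 11 \<in> {0, 1, 3, 4, 5, 9}"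
proof -
  define x where "x = a mod 11"
  have "a\<^sup>2 mod 11 = x\<^sup>2 mod 11"
    by (simp add: x_def power_mod)
  moreover have "x \<in> set [0..10]"
    using pos_mod_bound[of 11 a] by (simp add: x_def)
  hence "x \<in> set [0, 1, 2, 3, 4, 5, 6, 7, 8, 9, 10]"
    by (simp add: upto_rec1)
  hence "x\<^sup>2 mod 11 \<in> {0, 1, 3, 4, 5, 9}"
    by auto
  ultimately show ?thesis by simp
qed

text \<open>-3 is not a square modulo 11, so the form is anisotropic.\<close>

lemma dvd_11_sum_of_squares:
  fixes a b :: int
  assumes "11 dvd 3 * a\<^sup>2 + b\<^sup>2"
  shows   "11 dvd a" "11 dvd b"
proof -
  have *: "u mod 11 = 0 \<and> v mod 11 = 0" if "u mod 11 \<in> {0, 1, 3, 4, 5, 9}" "v mod 11 \<in> {0, 1, 3, 4, 5, 9}"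
    "11 dvd 3 * u + v" for u v :: int
  proof -
    have "(3 * (u mod 11) + v mod 11) mod 11 = (3 * u + v) mod 11"
      by (intro mod_add_cong mod_mult_right_eq mod_mod_trivial)
    also have "\<dots> = 0"
      using that(3) by (rule dvd_imp_mod_0)
    finally show ?thesis using that(1,2) by auto
  qed
  have "11 dvd a\<^sup>2" "11 dvd b\<^sup>2"
    using *[OF square_mod_11 square_mod_11 assms] by (auto intro: mod_0_imp_dvd)
  moreover have "prime (11 :: int)" by simp
  ultimately show "11 dvd a" "11 dvd b"
    by (meson prime_dvd_power)+
qed

lemma dvd_zgf:
  assumes "\<And>x. x \<in> A \<Longrightarrow> e x = int n \<Longrightarrow> d dvd w x"
  shows   "d dvd fps_nth (zgf A e w) n"
  using assms by (auto simp: zgf_def intro!: dvd_sum)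

lemma dvd_qweight:
  assumes "\<rho> \<in> {0, 1}" "qexp \<rho> x mod 11 = 7"
  shows   "11 dvd qweight \<rho> x"
proof -
  obtain r i where x: "x = (r, i)" by (cases x)
  \<comment> \<open>Completing the square; 12 clears the denominators for both values of \<rho>. At
    residue 7 the left side is 12 * 7 + 4 = 88 = 0 modulo 11.\<close>
  have "12 * qexp \<rho> x + 4 = 3 * (2 * i - 3 * r - \<rho>)\<^sup>2 + (3 * r - 2 + \<rho>)\<^sup>2"
    using assms(1) by (auto simp: x qexp_def algebra_simps power2_eq_square)
  moreover define c where "c = qexp \<rho> x div 11"
  have "11 * c + qexp \<rho> x mod 11 = qexp \<rho> x"
    unfolding c_def by (rule mult_div_mod_eq)
  hence "qexp \<rho> x = 11 * c + 7"
    unfolding assms(2) by (rule sym)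
  hence "12 * qexp \<rho> x + 4 = 11 * (12 * c + 8)"
    by simp
  hence "11 dvd 12 * qexp \<rho> x + 4"
    by (rule dvdI)
  ultimately have "11 dvd 3 * (2 * i - 3 * r - \<rho>)\<^sup>2 + (3 * r - 2 + \<rho>)\<^sup>2"
    by (simp only:)
  note dvd_11_sum_of_squares[OF this]
  \<comment> \<open>Adding the two linear forms eliminates r and leaves a multiple of the factor i -
    1 of the weight.\<close>
  hence "11 dvd (2 * i - 3 * r - \<rho>) + (3 * r - 2 + \<rho>)"
    by (rule dvd_add)
  also have "(2 * i - 3 * r - \<rho>) + (3 * r - 2 + \<rho>) = 2 * (i - 1)"
    by simp
  finally have "11 dvd i - 1"
    by presburger
  thus ?thesis
    by (simp add: x qweight_def power2_eq_square)
qed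

lemma dvd_euler_power_8:
  assumes "n mod 11 = 7"
  shows   "11 dvd fps_nth (euler ^ 8) n"
proof -
  have "11 dvd fps_nth (zgf UNIV (qexp \<rho>) (qweight \<rho>)) n" if "\<rho> \<in> {0, 1}" for \<rho>
    using assms by (intro dvd_zgf dvd_qweight that) presburger
  hence "11 dvd fps_nth (-2 * euler ^ 8) n"
    unfolding euler_power_8 by (simp add: dvd_add)
  also have "-2 * euler ^ 8 = fps_const (-2) * euler ^ 8"
    unfolding fps_numeral_fps_const fps_const_neg ..
  finally have "11 dvd (-2) * fps_nth (euler ^ 8) n"
    by (simp only: fps_mult_left_const_nth)
  thus ?thesis by presburger
qed

section \<open>Congruences modulo 11\<close>

text \<open>A case of Lucas' theorem. If r = m mod 11 is at most 9, then 11 divides m - r and hence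
  the binomial of m - r over 10 - r, while the binomial of 10 over r is prime to 11.\<close>

lemma not_dvd_11_binomial_10:
  assumes "\<not> 11 dvd (m choose 10)"
  shows   "m mod 11 = 10"
proof (rule ccontr)
  assume *: "m mod 11 \<noteq> 10"
  define r where "r = m mod 11"
  have r: "r \<le> 9" using * by (simp add: r_def)
  have "m \<ge> 10"
    using assms by (metis binomial_eq_0 dvd_0_right not_less)
  have "(m choose 10) * (10 choose r) = (m choose r) * ((m - r) choose (10 - r))"
    using r \<open>m \<ge> 10\<close> by (intro choose_mult) auto
  moreover have "11 dvd ((m - r) choose (10 - r))"
  proof -
    obtain k where k: "10 - r = Suc k" using r by (cases "10 - r") auto
    have "(10 - r) * ((m - r) choose (10 - r)) = (m - r) * ((m - r - 1) choose (10 - r - 1))"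
      using r by (intro times_binomial_minus1_eq) auto
    moreover have "11 dvd m - r" by (simp add: r_def)
    ultimately have "11 dvd (10 - r) * ((m - r) choose (10 - r))" by simp
    moreover have "\<not> 11 dvd 10 - r"
      using r nat_dvd_not_less[of "10 - r" 11] by simp
    moreover have "prime (11 :: nat)" by simp
    ultimately show ?thesis using prime_dvd_mult_iff by blast
  qed
  ultimately have "11 dvd (m choose 10) * (10 choose r)" by simp
  moreover have "\<not> 11 dvd (10 choose r)"
  proof
    assume "11 dvd (10 choose r)"
    moreover have "fact r * fact (10 - r) * (10 choose r) = fact 10"
      using r by (intro binomial_fact_lemma) simp
    ultimately have "11 dvd (fact 10 :: nat)"
      by (metis dvd_mult)
    thus False by (simp add: prime_dvd_fact_iff)
  qed
  moreover have "prime (11 :: nat)" by simp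
  ultimately show False using assms prime_dvd_mult_iff by blast
qed

text \<open>Reduction to the lower index 10, the last digit of 21 in base 11: the binomial of 21
  over 10 is prime to 11.\<close>

lemma not_dvd_11_binomial_21:
  assumes "\<not> 11 dvd (m choose 21)"
  shows   "m mod 11 = 10"
proof (rule not_dvd_11_binomial_10, rule notI)
  assume *: "11 dvd (m choose 10)"
  have "m \<ge> 21"
    using assms by (metis binomial_eq_0 dvd_0_right not_less)
  hence "(m choose 21) * (21 choose 10) = (m choose 10) * ((m - 10) choose (21 - 10))"
    by (intro choose_mult) auto
  hence "11 dvd (m choose 21) * (21 choose 10)"
    using * by simp
  moreover have "(21 choose 10) = (352716 :: nat)"
    by (simp add: binomial_fact' fact_numeral)
  ultimately have "11 dvd (m choose 21) * 352716"
    by (simp only:)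
  moreover have "\<not> 11 dvd (352716 :: nat)" "prime (11 :: nat)"
    by simp_all
  ultimately show False
    using assms prime_dvd_mult_iff by blast
qed

section \<open>Series in \<open>X^11\<close> modulo 11\<close>

definition supp11 :: "int fps \<Rightarrow> bool" where
  "supp11 f \<longleftrightarrow> (\<forall>n. \<not> 11 dvd n \<longrightarrow> 11 dvd fps_nth f n)"

lemma supp11_mult:
  assumes "supp11 f" "supp11 g"
  shows   "supp11 (f * g)"
  unfolding supp11_def
proof safe
  fix n :: nat assume n: "\<not> 11 dvd n"
  have "11 dvd fps_nth f i * fps_nth g (n - i)" if "i \<le> n" for i
  proof (cases "11 dvd i")
    case True
    hence "\<not> 11 dvd n - i" using n that by (metis dvd_diffD)
    thus ?thesis using assms(2) by (simp add: supp11_def)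
  qed (use assms(1) in \<open>simp add: supp11_def\<close>)
  thus "11 dvd fps_nth (f * g) n"
    unfolding fps_mult_nth by (intro dvd_sum) auto
qed

text \<open>The Frobenius map: 11 divides the inner binomial coefficients, and the outer terms are 1
  and -X^(11k).\<close>

lemma supp11_one_minus_X_power: "supp11 ((1 - fps_X ^ k) ^ 11)"
  unfolding supp11_def
proof safe
  fix n :: nat assume n: "\<not> 11 dvd n"
  have "(1 - fps_X ^ k :: int fps) ^ 11 = (- (fps_X ^ k) + 1) ^ 11"
    by simp
  also have "\<dots> = (\<Sum>j\<le>11. of_nat (11 choose j) * (- (fps_X ^ k)) ^ j * 1 ^ (11 - j))"
    by (rule binomial_ring)
  also have "fps_nth \<dots> n = (\<Sum>j\<le>11. int (11 choose j) * fps_nth ((- (fps_X ^ k)) ^ j) n)"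
  proof -
    have "of_nat c = fps_const (int c)" for c
      using fps_of_nat[of c, where 'a = int] by simp
    thus ?thesis by (simp add: fps_sum_nth)
  qed
  also have "11 dvd \<dots>"
  proof (rule dvd_sum)
    fix j :: nat assume "j \<in> {..11}"
    then consider "j = 0" | "j = 11" | "0 < j" "j < 11" by fastforce
    thus "11 dvd int (11 choose j) * fps_nth ((- (fps_X ^ k)) ^ j) n"
    proof cases
      case 1
      thus ?thesis using n by (cases "n = 0") auto
    next
      case 2
      have *: "(- (fps_X ^ k) :: int fps) ^ j = - (fps_X ^ (k * 11))"
        unfolding 2 power_mult by simp
      have "n \<noteq> k * 11" using n by auto
      thus ?thesis unfolding * fps_neg_nth fps_X_power_nth by simp
    next
      case 3
      have "11 dvd (11 choose j)"
        by (rule dvd_choose_prime) (use 3 in auto)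
      hence "int 11 dvd int (11 choose j)"
        unfolding int_dvd_int_iff .
      thus ?thesis by simp
    qed
  qed
  finally show "11 dvd fps_nth ((1 - fps_X ^ k :: int fps) ^ 11) n" .
qed

lemma supp11_euler_power_11: "supp11 (euler ^ 11)"
proof -
  have *: "supp11 (qpoch fps_X N ^ 11)" for N
  proof (induction N)
    case 0
    show ?case by (simp add: qpoch_def supp11_def)
  next
    case (Suc N)
    show ?case
      unfolding qpoch_Suc power_mult_distrib
      by (intro supp11_mult Suc supp11_one_minus_X_power)
  qed
  show ?thesis
    unfolding supp11_def
  proof safe
    fix n :: nat assume n: "\<not> 11 dvd n"
    have "fps_nth (euler ^ 11) n = fps_nth (qpoch fps_X n ^ 11) n"
      using agree_power[OF agree_qpoch_euler[of n n], of 11] by (simp add: agree_def)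
    thus "11 dvd fps_nth (euler ^ 11) n"
      using *[of n] n by (simp add: supp11_def)
  qed
qed

text \<open>A binomial prime to 11 needs n + 10 or n + 11 to be 10 modulo 11, so 11 divides n or n +
  1 and thus n(n+1)/2.\<close>

lemma dvd_Wcoeff_10:
  assumes "\<not> 11 dvd (Suc n choose 2)"
  shows   "11 dvd Wcoeff n 10"
proof -
  have even: "2 * (Suc n choose 2) = Suc n * n"
    by (induction n) (simp_all add: numeral_2_eq_2)
  have "11 dvd (m choose 21)" if "m \<in> {n + 10, n + 11}" for m
  proof (rule ccontr)
    assume "\<not> 11 dvd (m choose 21)"
    hence "m mod 11 = 10" by (rule not_dvd_11_binomial_21)
    hence "11 dvd n \<or> 11 dvd Suc n" using that by auto presburger+
    hence "11 dvd 2 * (Suc n choose 2)" unfolding even by (metis dvd_mult dvd_mult2)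
    thus False using assms by presburger
  qed
  hence "11 dvd (n + 10 + 1 choose (2 * 10 + 1)) + (n + 10 choose (2 * 10 + 1))"
    by (intro dvd_add) simp_all
  hence "int 11 dvd int ((n + 10 + 1 choose (2 * 10 + 1)) + (n + 10 choose (2 * 10 + 1)))"
    unfolding int_dvd_int_iff .
  thus ?thesis
    unfolding Wcoeff_def by simp
qed

lemma supp11_triseries_Wcoeff: "supp11 (triseries (\<lambda>n. (-1) ^ n * Wcoeff n 10))"
  unfolding supp11_def triseries_def fps_nth_Abs_fps
  by (intro allI impI dvd_sum) (auto intro!: dvd_mult dvd_Wcoeff_10 simp del: binomial_Suc_Suc)

text \<open>Modulo 11, f is a series in X^11 with constant term 1, so dividing by it mixes only
  coefficients whose indices lie in one residue class.\<close>

lemma dvd_nth_of_mult: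
  assumes "supp11 f" "fps_nth f 0 = 1" and fg: "\<And>n. n mod 11 = 7 \<Longrightarrow> 11 dvd fps_nth (f * g) n"
  shows   "n mod 11 = 7 \<Longrightarrow> 11 dvd fps_nth g n"
proof (induction n rule: less_induct)
  case (less n)
  have "fps_nth (f * g) n = fps_nth g n + (\<Sum>i=1..n. fps_nth f i * fps_nth g (n - i))"
    unfolding fps_mult_nth using assms(2) by (subst sum.atLeast_Suc_atMost) auto
  moreover have "11 dvd (\<Sum>i=1..n. fps_nth f i * fps_nth g (n - i))"
  proof (rule dvd_sum)
    fix i assume i: "i \<in> {1..n}"
    show "11 dvd fps_nth f i * fps_nth g (n - i)"
    proof (cases "11 dvd i")
      case True
      hence "(n - i) mod 11 = 7"
      proof -
        obtain k where k: "i = 11 * k" using True by (elim dvdE)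
        have "(n - i) mod 11 = (n - i + 11 * k) mod 11" by simp
        also have "n - i + 11 * k = n" using i k by simp
        finally show ?thesis using less.prems by simp
      qed
      hence "11 dvd fps_nth g (n - i)"
        using less.IH[of "n - i"] i by simp
      thus ?thesis by (rule dvd_mult)
    qed (use assms(1) in \<open>simp add: supp11_def\<close>)
  qed
  ultimately show ?case
    using fg[OF less.prems] by (simp add: dvd_add_left_iff)
qed

theorem theorem1p5:
  fixes n :: nat
  shows "[MO 10 (11 * n + 7) = 0] (mod 11)"
proof -
  define G where "G = triseries (\<lambda>n. (-1) ^ n * Wcoeff n 10)"
  have "11 dvd fps_nth (MO_gf 10) (11 * n + 7)"
  \<comment> \<open>The eleventh power supplies the cube that turns \<open>MO_gf 10\<close> into
    \<open>G\<close> and leaves \<open>euler ^ 8\<close>.\<close>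
  proof (rule dvd_nth_of_mult[OF supp11_euler_power_11])
    fix m :: nat assume m: "m mod 11 = 7"
    have "euler ^ 11 * MO_gf 10 = euler ^ 8 * (euler ^ 3 * MO_gf 10)"
      by (simp flip: power_add mult.assoc)
    also have "\<dots> = euler ^ 8 * G"
      unfolding euler_cube_mult_MO_gf G_def ..
    also have "11 dvd fps_nth \<dots> m"
      unfolding fps_mult_nth
    proof (rule dvd_sum)
      fix i assume i: "i \<in> {0..m}"
      show "11 dvd fps_nth (euler ^ 8) i * fps_nth G (m - i)"
      \<comment> \<open>\<open>G\<close> is a series in X^11 modulo 11, so only indices i = 7 modulo
        11 of \<open>euler ^ 8\<close> remain, and there its coefficients vanish modulo 11.\<close>
      proof (cases "11 dvd m - i")
        case True
        hence "i mod 11 = 7"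
          using m i mod_eq_dvd_iff_nat[of i m 11] by simp
        thus ?thesis using dvd_euler_power_8 by simp
      next
        case False
        thus ?thesis using supp11_triseries_Wcoeff by (simp add: supp11_def G_def)
      qed
    qed
    finally show "11 dvd fps_nth (euler ^ 11 * MO_gf 10) m" .
  qed (simp_all add: fps_nth_power_0)
  thus ?thesis
    by (simp add: MO_def cong_0_iff)
qed

end
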